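(* There is an absolute constant $c>0$ such that for every finite set $A\subset \mathbb{R}$ with $|A|\ge 2$, $$|A:A + A:A| \ge c\, |A:A|^{\frac{14}{29}}\, |A|^{\frac{30}{29}}\, (\log |A|)^{-\frac{2}{29}},$$ and $$|AA + AA| \ge c\, |AA|^{\frac{19}{29}}\, |A:A|^{-\frac{5}{29}}\, |A|^{\frac{30}{29}}\, (\log |A|)^{-\frac{2}{29}}.$$
   Context: For finite $X,Y\subset\mathbb{R}$: $X+Y=\{x+y: x\in X, y\in Y\}$, $XY=\{xy: x\in X,y\in Y\}$, $X:Y=\{x/y: x\in X, y\in Y, y\neq 0\}$. So $A:A+A:A=\{a/b+c/d: a,b,c,d\in A,\ b,d\ne0\}$ and $AA+AA=\{ab+cd: a,b,c,d\in A\}$. Logarithms are base 2. *)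

theory Defs
  imports Complex_Main "HOL-Library.Set_Algebras"
begin

text \<open>The sumset \<open>X + Y\<close> and the product set \<open>X * Y\<close> are the elementwise operations of
  \<^theory>\<open>HOL-Library.Set_Algebras\<close>.\<close>

definition ratio_set :: "real set \<Rightarrow> real set \<Rightarrow> real set" where
  "ratio_set X Y = {x / y | x y. x \<in> X \<and> y \<in> Y \<and> y \<noteq> 0}"

end

theory Submission imports Defs begin

text \<open>
  Let \<open>Q\<close> be \<open>A A\<close> or \<open>A : A\<close>, \<open>P\<close> the larger sign class of \<open>A\<close>, and let \<open>g\<close>, \<open>a\<close> range over \<open>A\<close>,
  \<open>b\<close> over \<open>P\<close>. The points \<open>(q, q b / g)\<close>, with \<open>g\<close> a factor of \<open>q\<close>, lie in \<open>Q \<times> Q\<close> on lines through the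
  origin whose slopes \<open>b / g\<close> belong to \<open>A : A\<close>. As in Solymosi's argument, sums of points on
  neighbouring lines are distinct and fill disjoint sectors, so that few lines carry many points.

  The gain comes from slopes with many representations \<open>b / g\<close>. For each representation the line
  contains the dilate of \<open>P\<close> (or of \<open>1 / P\<close>) by \<open>g\<close>. Take a block of \<open>2 h\<close> consecutive slopes. If sums of points on these
  lines coincided too often, then projecting a coincidence along one of the slopes would produce
  too many incidences between \<open>P \<times> P\<close> and lines of \<open>t\<close> different directions, one for each representation;
  an elementary Szemeredi--Trotter bound for Cartesian products excludes this once \<open>t\<close> exceeds a
  multiple of \<open>h ^ 5\<close>. Hence blocks of length \<open>t powr (1/5)\<close> may be used instead of pairs of lines.

  Slopes with few representations are avoided as follows. An element of \<open>S \<subseteq> A\<close> is good if most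
  of its slopes are popular; all but a tiny proportion of \<open>S\<close> is good. Elements of \<open>Q\<close> with a good factor
  are bounded by interpolating the two estimates above (with weights \<open>351/551\<close> and \<open>200/551\<close>), and the
  remaining ones come from the much smaller set of bad elements, to which the argument is applied again.
\<close>

section \<open>Incidences between lines and a Cartesian square\<close>

lemma block_rank_mono:
  fixes C :: "real set"
  assumes "finite C" "x \<le> y"
  shows "card {u \<in> C. u < x} div q \<le> card {u \<in> C. u < y} div q"
  using assms by (intro div_le_mono card_mono) auto

lemma rank_inj:
  fixes C :: "real set"
  assumes "finite C"
  shows "inj_on (\<lambda>x. card {u \<in> C. u < x}) C"
proof (rule linorder_inj_onI)
  fix x y assume xy: "x < y" "x \<in> C" "y \<in> C"
  have "{u \<in> C. u < x} \<subset> {u \<in> C. u < y}" using xy by force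
  then have "card {u \<in> C. u < x} < card {u \<in> C. u < y}"
    using assms by (intro psubset_card_mono) auto
  then show "card {u \<in> C. u < x} \<noteq> card {u \<in> C. u < y}" by simp
qed auto

text \<open>The rank is injective on \<open>C\<close>, and the ranks with quotient \<open>v\<close>
  fill an interval of \<open>q\<close> integers.\<close>

lemma card_block_le:
  fixes C :: "real set"
  assumes "finite C" "q > 0"
  shows "card {x \<in> C. card {u \<in> C. u < x} div q = v} \<le> q"
proof -
  let ?r = "\<lambda>x. card {u \<in> C. u < x}"
  have "card {x \<in> C. ?r x div q = v} \<le> card {v * q..<v * q + q}"
  proof (rule card_inj_on_le[where f = ?r])
    show "inj_on ?r {x \<in> C. ?r x div q = v}"
      by (rule inj_on_subset[OF rank_inj[OF assms(1)]]) auto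
    show "?r ` {x \<in> C. ?r x div q = v} \<subseteq> {v * q..<v * q + q}"
    proof
      fix z assume "z \<in> ?r ` {x \<in> C. ?r x div q = v}"
      then have "z div q = v" by auto
      then have "z = v * q + z mod q" using div_mult_mod_eq[of z q] by simp
      moreover have "z mod q < q" using assms(2) by simp
      ultimately show "z \<in> {v * q..<v * q + q}" by (metis atLeastLessThan_iff le_add1 nat_add_left_cancel_less)
    qed
  qed auto
  then show ?thesis by simp
qed

text \<open>A Szemeredi--Trotter bound for Cartesian products: cut \<open>C\<close> into blocks of \<open>q\<close> consecutive
  elements; a line is monotone and hence visits few cells, and two points of a cell determine the line.\<close>

lemma grid_incidences:
  fixes C :: "real set" and L :: "(real \<times> real) set"
  assumes fC: "finite C" and fL: "finite L" and q: "q > 0"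
    and slope: "\<And>m k. (m, k) \<in> L \<Longrightarrow> m \<noteq> 0"
  shows "card {(p, l). p \<in> C \<times> C \<and> l \<in> L \<and> snd p = fst l * fst p + snd l}
    \<le> (2 * (card C div q) + 1) * card L + q\<^sup>2 * (card C)\<^sup>2"
proof -
  define g where "g = (\<lambda>x. card {u \<in> C. u < x} div q)"
  define cell where "cell = (\<lambda>p :: real \<times> real. (g (fst p), g (snd p)))"
  define on where "on = (\<lambda>(p :: real \<times> real) (l :: real \<times> real). snd p = fst l * fst p + snd l)"
  define Inc where "Inc = {(p, l). p \<in> C \<times> C \<and> l \<in> L \<and> on p l}"
  \<comment> \<open>One distinguished point for each line and each cell it visits. It is consulted
    only at cells of actual incidences, where a witness exists.\<close>
  define rep where "rep = (\<lambda>l k. SOME p. p \<in> C \<times> C \<and> on p l \<and> cell p = k)"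
  have rep: "rep l (cell p) \<in> C \<times> C \<and> on (rep l (cell p)) l \<and> cell (rep l (cell p)) = cell p"
    if "(p, l) \<in> Inc" for p l
    unfolding rep_def by (rule someI[of _ p]) (use that in \<open>auto simp: Inc_def\<close>)
  have finInc: "finite Inc"
    by (rule finite_subset[of _ "(C \<times> C) \<times> L"]) (auto simp: Inc_def fC fL)
  have gmono: "g x \<le> g y" if "x \<le> y" for x y
    unfolding g_def using block_rank_mono[OF fC that] .
  have gle: "g x \<le> card C div q" for x
    unfolding g_def using fC by (intro div_le_mono card_mono) auto
  \<comment> \<open>Distinguished incidences are charged to the cells visited by a line, all others
    to pairs of points sharing a cell.\<close>
  define Inc1 where "Inc1 = {(p, l) \<in> Inc. p = rep l (cell p)}"
  define Inc2 where "Inc2 = {(p, l) \<in> Inc. p \<noteq> rep l (cell p)}"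
  have "Inc = Inc1 \<union> Inc2" by (auto simp: Inc1_def Inc2_def)
  then have "card Inc \<le> card Inc1 + card Inc2" by (simp add: card_Un_le)
  moreover have "card Inc1 \<le> (2 * (card C div q) + 1) * card L"
  proof -
    \<comment> \<open>Along a line of positive slope both cell indices are nondecreasing, so their
      sum identifies the cell. For negative slope the second index is reflected; by
      \<open>gle\<close> this subtraction never truncates.\<close>
    define code where "code = (\<lambda>(p :: real \<times> real, l :: real \<times> real).
      (if fst l > 0 then g (fst p) + g (snd p) else g (fst p) + (card C div q - g (snd p)), l))"
    have "inj_on code Inc1"
    proof (rule inj_onI)
      fix a b assume a: "a \<in> Inc1" and b: "b \<in> Inc1" and eq: "code a = code b"
      obtain p l where pl: "a = (p, l)" by (cases a)
      obtain p' where p': "b = (p', l)" using eq pl by (cases b) (auto simp: code_def)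
      have in1: "(p, l) \<in> Inc" "(p', l) \<in> Inc" and r: "p = rep l (cell p)" "p' = rep l (cell p')"
        using a b pl p' by (auto simp: Inc1_def)
      have on: "on p l" "on p' l" using in1 by (simp_all add: Inc_def)
      have "(fst l, snd l) \<in> L" using in1 by (simp add: Inc_def)
      then have l0: "fst l \<noteq> 0" by (rule slope)
      have "cell p = cell p'"
      proof (cases "fst l > 0")
        case True
        have mon: "g (fst x) \<le> g (fst y) \<and> g (snd x) \<le> g (snd y)"
          if "fst x \<le> fst y" "on x l" "on y l" for x y
        proof -
          have "snd x \<le> snd y" using that True by (simp add: on_def)
          then show ?thesis using gmono that by auto
        qed
        have s: "g (fst p) + g (snd p) = g (fst p') + g (snd p')"
          using eq True by (simp add: code_def pl p')
        consider "fst p \<le> fst p'" | "fst p' \<le> fst p" by linarith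
        then show ?thesis
          using mon[of p p'] mon[of p' p] on s by cases (simp_all add: cell_def)
      next
        case False
        then have neg: "fst l < 0" using l0 by auto
        have mon: "g (fst x) \<le> g (fst y) \<and> g (snd y) \<le> g (snd x)"
          if "fst x \<le> fst y" "on x l" "on y l" for x y
        proof -
          have "snd y \<le> snd x" using that neg by (simp add: on_def)
          then show ?thesis using gmono that by auto
        qed
        have s: "g (fst p) + (card C div q - g (snd p)) = g (fst p') + (card C div q - g (snd p'))"
          using eq False by (simp add: code_def pl p')
        consider "fst p \<le> fst p'" | "fst p' \<le> fst p" by linarith
        then have "g (fst p) = g (fst p') \<and> g (snd p) = g (snd p')"
        proof cases
          case 1
          then show ?thesis using mon[of p p'] on s gle[of "snd p"] gle[of "snd p'"] by linarith
        next
          case 2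
          then show ?thesis using mon[of p' p] on s gle[of "snd p"] gle[of "snd p'"] by linarith
        qed
        then show ?thesis by (simp add: cell_def)
      qed
      then show "a = b" using r pl p' by metis
    qed
    moreover have "code ` Inc1 \<subseteq> {..2 * (card C div q)} \<times> L"
    proof -
      have "g x + g y \<le> 2 * (card C div q)" "g x + (card C div q - g y) \<le> 2 * (card C div q)" for x y
        using gle[of x] gle[of y] by linarith+
      then show ?thesis by (auto simp: code_def Inc1_def Inc_def)
    qed
    ultimately have "card Inc1 \<le> card ({..2 * (card C div q)} \<times> L)"
      by (intro card_inj_on_le[where f = code]) (auto simp: fL)
    then show ?thesis by (simp add: card_cartesian_product)
  qed
  moreover have "card Inc2 \<le> q\<^sup>2 * (card C)\<^sup>2"
  proof -
    \<comment> \<open>Two distinct points fix the line. No line is vertical, so their abscissae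
      differ and the slope can be solved for.\<close>
    define pr where "pr = (\<lambda>(p, l). (p, rep l (cell p)))"
    define W where "W = (SIGMA p : C \<times> C. {p' \<in> C \<times> C. cell p' = cell p})"
    have "inj_on pr Inc2"
    proof (rule inj_onI)
      fix a b assume a: "a \<in> Inc2" and b: "b \<in> Inc2" and eq: "pr a = pr b"
      obtain p l where pl: "a = (p, l)" by (cases a)
      obtain l' where l': "b = (p, l')" using eq pl by (cases b) (auto simp: pr_def)
      define p0 where "p0 = rep l (cell p)"
      have p0': "p0 = rep l' (cell p)" using eq by (simp add: pr_def pl l' p0_def)
      have ne: "p \<noteq> p0" and i: "(p, l) \<in> Inc" "(p, l') \<in> Inc"
        using a b by (auto simp: Inc2_def pl l' p0_def)
      have on: "on p l" "on p l'" "on p0 l" "on p0 l'"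
        using i rep[OF i(1)] rep[OF i(2)] by (auto simp: Inc_def p0_def[symmetric] p0'[symmetric])
      have "fst p \<noteq> fst p0" using ne on(1,3) by (auto simp: on_def prod_eq_iff)
      moreover have "(fst l - fst l') * (fst p - fst p0) = 0"
        using on by (simp add: on_def algebra_simps)
      ultimately have "fst l = fst l'" by simp
      then have "l = l'" using on(1,2) by (auto simp: on_def prod_eq_iff)
      then show "a = b" by (simp add: pl l')
    qed
    moreover have "pr ` Inc2 \<subseteq> W"
    proof
      fix z assume "z \<in> pr ` Inc2"
      then obtain p l where i: "(p, l) \<in> Inc" and z: "z = (p, rep l (cell p))"
        by (auto simp: pr_def Inc2_def)
      have "p \<in> C \<times> C" using i by (simp add: Inc_def)
      then show "z \<in> W" unfolding W_def z using rep[OF i] by blast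
    qed
    moreover have finW: "finite W" unfolding W_def using fC by auto
    ultimately have "card Inc2 \<le> card W" by (intro card_inj_on_le[where f = pr])
    also have "card W = (\<Sum>p\<in>C \<times> C. card {p' \<in> C \<times> C. cell p' = cell p})"
      unfolding W_def using fC by (intro card_SigmaI) auto
    also have "\<dots> \<le> (\<Sum>p\<in>C \<times> C. q\<^sup>2)"
    proof (rule sum_mono)
      fix p assume "p \<in> C \<times> C"
      have "{p' \<in> C \<times> C. cell p' = cell p} = {x \<in> C. g x = g (fst p)} \<times> {x \<in> C. g x = g (snd p)}"
        by (auto simp: cell_def)
      then have "card {p' \<in> C \<times> C. cell p' = cell p}
          = card {x \<in> C. g x = g (fst p)} * card {x \<in> C. g x = g (snd p)}"
        by (simp add: card_cartesian_product)
      also have "\<dots> \<le> q * q"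
        unfolding g_def by (intro mult_le_mono card_block_le fC q)
      finally show "card {p' \<in> C \<times> C. cell p' = cell p} \<le> q\<^sup>2" by (simp add: power2_eq_square)
    qed
    also have "\<dots> = q\<^sup>2 * (card C)\<^sup>2" by (simp add: card_cartesian_product power2_eq_square)
    finally show ?thesis .
  qed
  ultimately have "card Inc \<le> (2 * (card C div q) + 1) * card L + q\<^sup>2 * (card C)\<^sup>2"
    by (meson add_mono le_trans)
  then show ?thesis by (simp add: Inc_def on_def)
qed

section \<open>Counting points in disjoint sectors\<close>

lemma initial_subset:
  fixes E :: "real set"
  assumes "finite E" "M \<le> card E"
  shows "\<exists>I\<subseteq>E. card I = M \<and> (\<forall>a\<in>I. \<forall>b\<in>E - I. a < b)"
  using assms(2)
proof (induction M)
  case 0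
  then show ?case by (intro exI[of _ "{}"]) auto
next
  case (Suc M)
  then obtain I where I: "I \<subseteq> E" "card I = M" "\<forall>a\<in>I. \<forall>b\<in>E - I. a < b" by auto
  have fI: "finite I" using I assms finite_subset by blast
  have ne: "E - I \<noteq> {}"
  proof
    assume "E - I = {}"
    then have "I = E" using I by blast
    then show False using I Suc.prems by simp
  qed
  define m where "m = Min (E - I)"
  have m: "m \<in> E - I" "\<And>b. b \<in> E - I \<Longrightarrow> m \<le> b"
    unfolding m_def using Min_in[of "E - I"] Min_le[of "E - I"] ne assms by blast+
  show ?case
  proof (intro exI[of _ "insert m I"] conjI ballI)
    show "insert m I \<subseteq> E" using I m by auto
    show "card (insert m I) = Suc M" using I m fI by simp
    fix a b assume a: "a \<in> insert m I" and b: "b \<in> E - insert m I"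
    then have "m \<le> b" "m \<noteq> b" using m by auto
    then have "m < b" by simp
    moreover have "a \<in> I \<Longrightarrow> a < b" using I b by auto
    ultimately show "a < b" using a by auto
  qed
qed

text \<open>Peel off the \<open>M\<close> smallest slopes \<open>I\<close>. A point counted for
  \<open>I\<close> lies strictly below some ray of \<open>I\<close>, hence below every ray with
  slope in \<open>E - I\<close>, so no later block counts it again.\<close>

lemma sector_count:
  fixes E :: "real set" and Z :: "(real \<times> real) set"
  assumes "finite E" "finite Z" "M > 0"
    and "\<And>I. I \<subseteq> E \<Longrightarrow> card I = M \<Longrightarrow>
      v \<le> card {z \<in> Z. fst z > 0 \<and> (\<exists>a\<in>I. a * fst z < snd z) \<and> (\<exists>b\<in>I. snd z < b * fst z)}"
  shows "(card E div M) * v \<le> card Z"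
  using assms
proof (induction "card E" arbitrary: E Z rule: less_induct)
  case less
  show ?case
  proof (cases "card E < M")
    case True
    then show ?thesis by simp
  next
    case False
    then obtain I where I: "I \<subseteq> E" "card I = M" "\<forall>a\<in>I. \<forall>b\<in>E - I. a < b"
      using initial_subset[of E M] less.prems by auto
    define F where "F = {z \<in> Z. fst z > 0 \<and> (\<exists>a\<in>I. a * fst z < snd z) \<and> (\<exists>b\<in>I. snd z < b * fst z)}"
    \<comment> \<open>The induction continues with the points above some remaining ray; later blocks
      lose nothing, since they count only such points.\<close>
    define Z' where "Z' = {z \<in> Z. fst z > 0 \<and> (\<exists>a\<in>E - I. a * fst z < snd z)}"
    have fI: "finite I" using I less.prems finite_subset by blast
    have cE: "card E = card (E - I) + M"
      using I fI less.prems card_Diff_subset[OF fI I(1)] card_mono[of E I] by simp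
    have IH: "(card (E - I) div M) * v \<le> card Z'"
    proof (rule less.hyps)
      show "card (E - I) < card E" using cE less.prems by simp
      fix J assume J: "J \<subseteq> E - I" "card J = M"
      have "{z \<in> Z. fst z > 0 \<and> (\<exists>a\<in>J. a * fst z < snd z) \<and> (\<exists>b\<in>J. snd z < b * fst z)}
        = {z \<in> Z'. fst z > 0 \<and> (\<exists>a\<in>J. a * fst z < snd z) \<and> (\<exists>b\<in>J. snd z < b * fst z)}"
        using J by (auto simp: Z'_def)
      then show "v \<le> card {z \<in> Z'. fst z > 0 \<and> (\<exists>a\<in>J. a * fst z < snd z) \<and> (\<exists>b\<in>J. snd z < b * fst z)}"
        using less.prems(4)[of J] J by auto
    qed (use less.prems in \<open>auto simp: Z'_def\<close>)
    have "F \<inter> Z' = {}"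
    proof (rule equals0I)
      fix z assume "z \<in> F \<inter> Z'"
      then obtain a b where "b \<in> I" "a \<in> E - I" "fst z > 0" "snd z < b * fst z" "a * fst z < snd z"
        by (auto simp: F_def Z'_def)
      moreover from this have "b * fst z < a * fst z" using I by simp
      ultimately show False by linarith
    qed
    then have "card F + card Z' = card (F \<union> Z')"
      using less.prems by (subst card_Un_disjoint) (auto simp: F_def Z'_def)
    also have "\<dots> \<le> card Z" using less.prems by (intro card_mono) (auto simp: F_def Z'_def)
    finally have "card F + card Z' \<le> card Z" .
    moreover have "v \<le> card F" using less.prems(4)[OF I(1,2)] by (simp add: F_def)
    moreover have "card E div M = card (E - I) div M + 1" using cE less.prems by simp
    ultimately show ?thesis using IH by (simp add: algebra_simps)
  qed
qed

text \<open>An \<open>x\<close> in \<open>Y l\<close> encodes the point \<open>(x, l x)\<close>. For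
  slopes \<open>a < b\<close> a sum of a point on each line determines both summands and lies
  strictly between the two rays, so every pair of slopes has at least \<open>y^2\<close> sums in its
  sector.\<close>

lemma lines_grid_bound:
  fixes E Z1 Z2 :: "real set" and Y :: "real \<Rightarrow> real set" and y :: real
  assumes fin: "finite E" "finite Z1" "finite Z2" and y: "y \<ge> 0" and E0: "0 \<notin> E"
    and Y: "\<And>l. l \<in> E \<Longrightarrow> Y l \<subseteq> {0<..}" "\<And>l. l \<in> E \<Longrightarrow> y \<le> card (Y l)"
      "\<And>l. l \<in> E \<Longrightarrow> finite (Y l)"
    and sums: "\<And>l k x x'. \<lbrakk>l \<in> E; k \<in> E; x \<in> Y l; x' \<in> Y k\<rbrakk>
      \<Longrightarrow> x + x' \<in> Z1 \<and> l * x + k * x' \<in> Z2"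
  shows "card E * y\<^sup>2 \<le> 3 * (card Z1 * card Z2)"
proof -
  \<comment> \<open>Rounding \<open>y\<close> up loses nothing, because the cardinalities it bounds
    are integers.\<close>
  define v where "v = nat \<lceil>y\<rceil>"
  have v: "l \<in> E \<Longrightarrow> v \<le> card (Y l)" for l
    using Y(2)[of l] by (simp add: v_def ceiling_le_iff nat_le_iff)
  have yv: "y \<le> v" using y by (simp add: v_def)
  have main: "(card E div 2) * v\<^sup>2 \<le> card (Z1 \<times> Z2)"
  proof (rule sector_count)
    fix I assume I: "I \<subseteq> E" "card I = 2"
    then obtain a b where ab: "I = {a, b}" "a < b"
      by (metis card_2_iff insert_commute linorder_less_linear)
    define f where "f = (\<lambda>(x, x'). (x + x', a * x + b * x'))"
    have mem: "a \<in> E" "b \<in> E" using I ab by auto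
    have inj: "inj_on f (Y a \<times> Y b)"
    proof (rule inj_onI)
      fix p p' assume "f p = f p'"
      then have e: "fst p + snd p = fst p' + snd p'"
          "a * fst p + b * snd p = a * fst p' + b * snd p'"
        by (auto simp: f_def split: prod.splits)
      have "(b - a) * (snd p - snd p')
          = (a * fst p + b * snd p) - (a * fst p' + b * snd p') - a * ((fst p + snd p) - (fst p' + snd p'))"
        by (simp add: algebra_simps)
      then have "(b - a) * (snd p - snd p') = 0" using e by simp
      then have "snd p = snd p'" using ab by simp
      then show "p = p'" using e by (simp add: prod_eq_iff)
    qed
    have "v\<^sup>2 \<le> card (Y a) * card (Y b)"
      using v mem by (simp add: power2_eq_square mult_le_mono)
    also have "\<dots> = card (f ` (Y a \<times> Y b))"
      using inj by (simp add: card_image card_cartesian_product)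
    also have "\<dots> \<le> card {z \<in> Z1 \<times> Z2. fst z > 0 \<and> (\<exists>a\<in>I. a * fst z < snd z) \<and> (\<exists>b\<in>I. snd z < b * fst z)}"
    proof (rule card_mono)
      show "finite {z \<in> Z1 \<times> Z2. fst z > 0 \<and> (\<exists>a\<in>I. a * fst z < snd z) \<and> (\<exists>b\<in>I. snd z < b * fst z)}"
        using fin by auto
      show "f ` (Y a \<times> Y b) \<subseteq> {z \<in> Z1 \<times> Z2. fst z > 0 \<and> (\<exists>a\<in>I. a * fst z < snd z) \<and> (\<exists>b\<in>I. snd z < b * fst z)}"
      proof
        fix z assume "z \<in> f ` (Y a \<times> Y b)"
        then obtain x x' where x: "x \<in> Y a" "x' \<in> Y b" and z: "z = (x + x', a * x + b * x')"
          by (auto simp: f_def)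
        have pos: "x > 0" "x' > 0" using x Y(1) mem by auto
        have "a * x' < b * x'" "a * x < b * x" using ab pos by simp_all
        then have "a * fst z < snd z" "snd z < b * fst z" by (simp_all add: z algebra_simps)
        then show "z \<in> {z \<in> Z1 \<times> Z2. fst z > 0 \<and> (\<exists>a\<in>I. a * fst z < snd z) \<and> (\<exists>b\<in>I. snd z < b * fst z)}"
          using sums[OF mem x] pos by (auto simp: z ab)
      qed
    qed
    finally show "v\<^sup>2 \<le> card {z \<in> Z1 \<times> Z2. fst z > 0 \<and> (\<exists>a\<in>I. a * fst z < snd z) \<and> (\<exists>b\<in>I. snd z < b * fst z)}" .
  qed (use fin in auto)
  \<comment> \<open>A single slope forms no pair; there, translates of \<open>Y l\<close> and of its
    dilate by the nonzero \<open>l\<close> lie in \<open>Z1\<close> and \<open>Z2\<close>. With two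
    or more slopes, one left over by the pairing costs at most the factor 3.\<close>
  have nat_bound: "card E * v\<^sup>2 \<le> 3 * (card Z1 * card Z2)"
  proof (cases "card E \<le> 1")
    case True
    show ?thesis
    proof (cases "card E = 0 \<or> v = 0")
      case False
      then obtain l where l: "l \<in> E" by (metis card.empty ex_in_conv)
      then obtain x where x: "x \<in> Y l" using v[of l] False
        by (metis card.empty ex_in_conv le_zero_eq)
      have "(\<lambda>x'. x' + x) ` Y l \<subseteq> Z1" "(\<lambda>x'. l * x' + l * x) ` Y l \<subseteq> Z2"
        using sums[OF l l _ x] by auto
      moreover have "card ((\<lambda>x'. x' + x) ` Y l) = card (Y l)"
        by (intro card_image inj_onI) simp
      moreover have "card ((\<lambda>x'. l * x' + l * x) ` Y l) = card (Y l)"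
        using E0 l by (intro card_image inj_onI) auto
      ultimately have "card (Y l) \<le> card Z1" "card (Y l) \<le> card Z2"
        using fin card_mono by metis+
      then have "v * v \<le> card Z1 * card Z2" using v[OF l] by (meson le_trans mult_le_mono)
      moreover have "card E * v\<^sup>2 \<le> 1 * v\<^sup>2" using True by (rule mult_le_mono1)
      ultimately show ?thesis unfolding power2_eq_square by linarith
    qed auto
  next
    case False
    then have "card E \<le> 3 * (card E div 2)" by linarith
    then have "card E * v\<^sup>2 \<le> 3 * (card E div 2) * v\<^sup>2" by (rule mult_le_mono1)
    also have "\<dots> \<le> 3 * (card Z1 * card Z2)"
      using main by (simp add: card_cartesian_product mult.assoc)
    finally show ?thesis .
  qed
  have "card E * y\<^sup>2 \<le> card E * (real v)\<^sup>2"
    using y yv by (intro mult_left_mono power_mono) auto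
  also have "\<dots> = real (card E * v\<^sup>2)" by simp
  also have "\<dots> \<le> real (3 * (card Z1 * card Z2))" using nat_bound by (subst of_nat_le_iff)
  finally show ?thesis by simp
qed

section \<open>Sums over blocks of \<open>2 h\<close> slopes\<close>

text \<open>If the sector held too few sums, then for each of \<open>T\<close> choices of
  multipliers at least half of the pairs of points would have a coinciding sum. These coincidences
  become incidences of the grid on \<open>C\<close> with lines in \<open>T\<close> directions, more
  than \<open>grid_incidences\<close> permits.\<close>

lemma block_sums_bound:
  fixes I C :: "real set" and B :: "real \<Rightarrow> real set" and Z :: "(real \<times> real) set" and h :: nat
  assumes finZ: "finite Z" and I: "finite I" "card I = 2 * h" "h > 0"
    and C: "finite C" "C \<subseteq> {0<..}" "32 * h\<^sup>2 \<le> card C"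
    and B: "\<And>l. l \<in> I \<Longrightarrow> B l \<subseteq> {0<..}" "\<And>l. l \<in> I \<Longrightarrow> 2 ^ 15 * h ^ 5 < card (B l)"
    and sums: "\<And>l k a a' c c'. \<lbrakk>l \<in> I; k \<in> I; a \<in> B l; a' \<in> B k; c \<in> C; c' \<in> C\<rbrakk>
      \<Longrightarrow> (a * c + a' * c', l * (a * c) + k * (a' * c')) \<in> Z"
  shows "h\<^sup>2 * (card C)\<^sup>2
    \<le> 2 * card {z \<in> Z. fst z > 0 \<and> (\<exists>a\<in>I. a * fst z < snd z) \<and> (\<exists>b\<in>I. snd z < b * fst z)}"
proof (rule ccontr)
  define F where "F = {z \<in> Z. fst z > 0 \<and> (\<exists>a\<in>I. a * fst z < snd z) \<and> (\<exists>b\<in>I. snd z < b * fst z)}"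
  define n where "n = card C"
  define T where "T = 2 ^ 15 * h ^ 5 + (1::nat)"
  assume "\<not> ?thesis"
  then have small: "2 * card F < h\<^sup>2 * n\<^sup>2" by (simp add: F_def n_def)
  have n0: "n > 0" using C I by (auto simp: n_def intro!: Nat.gr0I)
  \<comment> \<open>The two summands are taken from opposite halves of the block, so that every
    lower slope is strictly below every upper one, also across two representations.\<close>
  obtain I1 where I1: "I1 \<subseteq> I" "card I1 = h" "\<forall>a\<in>I1. \<forall>b\<in>I - I1. a < b"
    using initial_subset[of I h] I by auto
  define I2 where "I2 = I - I1"
  have finI: "finite I1" "finite I2" using I1 I finite_subset by (auto simp: I2_def)
  have cI2: "card I2 = h" using I1 I finI by (simp add: I2_def card_Diff_subset)
  have I12: "k \<in> I1 \<Longrightarrow> l \<in> I2 \<Longrightarrow> k < l" for k l using I1 by (auto simp: I2_def)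
  have subI: "k \<in> I1 \<Longrightarrow> k \<in> I" "l \<in> I2 \<Longrightarrow> l \<in> I" for k l using I1 by (auto simp: I2_def)
  have "\<exists>f. inj_on f {..<T} \<and> f ` {..<T} \<subseteq> B l" if "l \<in> I" for l
  proof -
    have "T \<le> card (B l)" using B(2)[OF that] by (simp add: T_def)
    then obtain X where X: "X \<subseteq> B l" "card X = T" "finite X"
      using obtain_subset_with_card_n by metis
    then obtain f where "bij_betw f {0..<T} X" using ex_bij_betw_nat_finite by blast
    then show ?thesis using X by (intro exI[of _ f]) (auto simp: bij_betw_def atLeast0LessThan)
  qed
  then obtain b where b: "\<And>l. l \<in> I \<Longrightarrow> inj_on (b l) {..<T}" "\<And>l. l \<in> I \<Longrightarrow> b l ` {..<T} \<subseteq> B l"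
    by metis
  have T0: "0 < T" by (simp add: T_def)
  have bB: "b l t \<in> B l" "b l t > 0" if "l \<in> I" "t < T" for l t
    using b(2)[OF that(1)] B(1)[OF that(1)] that by (auto simp: image_subset_iff subset_iff)
  \<comment> \<open>Only the multipliers of the lower half vary with \<open>t\<close>. Those of the
    upper half stay fixed, which makes the slopes \<open>m t\<close> below pairwise
    distinct.\<close>
  define be where "be = (\<lambda>t l. if l \<in> I1 then b l t else b l 0)"
  have be: "be t l \<in> B l" "be t l > 0" if "l \<in> I" "t < T" for l t
    using bB[OF that] bB[OF that(1) T0] by (auto simp: be_def)
  define f where "f = (\<lambda>t (k, l, c, c'). (be t k * c + be t l * c', k * (be t k * c) + l * (be t l * c')))"
  define Rep where "Rep = I1 \<times> I2 \<times> C \<times> C"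
  have finRep: "finite Rep" using finI C by (simp add: Rep_def)
  have cRep: "card Rep = h\<^sup>2 * n\<^sup>2"
    by (simp add: Rep_def card_cartesian_product I1 cI2 n_def power2_eq_square)
  \<comment> \<open>The pairs whose sum has a second representation. All other pairs inject into
    \<open>F\<close>, so a small \<open>F\<close> forces at least half of \<open>Rep\<close> into
    this set.\<close>
  define NU where "NU = (\<lambda>t. {r \<in> Rep. \<exists>r'\<in>Rep. r' \<noteq> r \<and> f t r' = f t r})"
  have NU: "h\<^sup>2 * n\<^sup>2 \<le> 2 * card (NU t)" if "t < T" for t
  proof -
    have "inj_on (f t) (Rep - NU t)"
    proof (rule inj_onI)
      fix r r' assume "r \<in> Rep - NU t" "r' \<in> Rep - NU t" "f t r = f t r'"
      then show "r = r'" unfolding NU_def by (metis (mono_tags, lifting) DiffD1 DiffD2 mem_Collect_eq)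
    qed
    moreover have "f t ` (Rep - NU t) \<subseteq> F"
    proof
      fix z assume "z \<in> f t ` (Rep - NU t)"
      then obtain k l c c' where kl: "k \<in> I1" "l \<in> I2" "c \<in> C" "c' \<in> C"
        and z: "z = (be t k * c + be t l * c', k * (be t k * c) + l * (be t l * c'))"
        by (auto simp: Rep_def f_def)
      have kI: "k \<in> I" "l \<in> I" using kl subI by auto
      have pos: "be t k * c > 0" "be t l * c' > 0"
        using be[OF kI(1) that] be[OF kI(2) that] kl C by auto
      have "z \<in> Z" unfolding z
        using sums[OF kI be(1)[OF kI(1) that] be(1)[OF kI(2) that] kl(3,4)] .
      moreover have "k * fst z < snd z" "snd z < l * fst z"
      proof -
        have "k * (be t l * c') < l * (be t l * c')" "k * (be t k * c) < l * (be t k * c)"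
          using I12[OF kl(1,2)] pos by (simp_all only: mult_less_cancel_right_pos)
        then show "k * fst z < snd z" "snd z < l * fst z" by (simp_all add: z distrib_left)
      qed
      ultimately show "z \<in> F" using pos kI by (auto simp: F_def z)
    qed
    moreover have "finite F" using finZ by (simp add: F_def)
    ultimately have "card (Rep - NU t) \<le> card F" using card_inj_on_le by blast
    moreover have "card Rep \<le> card (Rep - NU t) + card (NU t)"
    proof -
      have "Rep = (Rep - NU t) \<union> NU t" by (auto simp: NU_def)
      then show ?thesis by (metis card_Un_le)
    qed
    ultimately show ?thesis using small cRep by linarith
  qed
  \<comment> \<open>Projection along slope \<open>j\<close> sends \<open>(x, i x)\<close> to
    \<open>(i - j) x\<close>; these are its values at the single points of the block.\<close>
  define Of where "Of = (\<lambda>t j. (\<lambda>(i, c). (i - j) * (be t i * c)) ` (I \<times> C))"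
  have cO: "card (Of t j) \<le> 2 * h * n" for t j
    unfolding Of_def using card_image_le[of "I \<times> C"] I C
    by (metis card_cartesian_product finite_SigmaI n_def)
  define G where "G = (\<lambda>t j k l. {(c, c'). c \<in> C \<and> c' \<in> C \<and>
      (k - j) * (be t k * c) + (l - j) * (be t l * c') \<in> Of t j})"
  have finG: "finite (G t j k l)" for t j k l
    by (rule finite_subset[of _ "C \<times> C"]) (use C in \<open>auto simp: G_def\<close>)
  define J where "J = {(j, k, l). j \<in> I \<and> k \<in> I1 \<and> l \<in> I2 \<and> j \<noteq> k \<and> j \<noteq> l}"
  have finJ: "finite J" and cJ: "card J \<le> 2 * h * h\<^sup>2"
  proof -
    have sub: "J \<subseteq> I \<times> I1 \<times> I2" by (auto simp: J_def)
    then show "finite J" using finite_subset I finI by blast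
    have "card J \<le> card (I \<times> I1 \<times> I2)" using sub I finI by (intro card_mono) auto
    then show "card J \<le> 2 * h * h\<^sup>2"
      by (simp add: card_cartesian_product I I1 cI2 power2_eq_square)
  qed
  text \<open>Projecting two different representations of a point along a slope \<open>j\<close> used by only one of
    them leaves a three-term relation, that is, an incidence.\<close>
  have NUle: "card (NU t) \<le> (\<Sum>(j, k, l)\<in>J. card (G t j k l))" if t: "t < T" for t
  proof -
    define W where "W = (SIGMA r : J. case r of (j, k, l) \<Rightarrow> G t j k l)"
    have "NU t \<subseteq> (\<lambda>((j, k, l), (c, c')). (k, l, c, c')) ` W"
    proof
      fix r assume "r \<in> NU t"
      then obtain r' where r': "r \<in> Rep" "r' \<in> Rep" "r' \<noteq> r" "f t r' = f t r"
        by (auto simp: NU_def)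
      obtain k l c c' where r: "r = (k, l, c, c')" by (metis prod_cases4)
      obtain i j d d' where r2: "r' = (i, j, d, d')" by (metis prod_cases4)
      have in1: "k \<in> I1" "l \<in> I2" "c \<in> C" "c' \<in> C" and in2: "i \<in> I1" "j \<in> I2" "d \<in> C" "d' \<in> C"
        and ne: "(i, j, d, d') \<noteq> (k, l, c, c')" and eq: "f t (i, j, d, d') = f t (k, l, c, c')"
        using r' by (simp_all add: Rep_def r r2)
      define x where "x = be t i * d"
      define y where "y = be t j * d'"
      define z where "z = be t k * c"
      define w where "w = be t l * c'"
      have e1: "x + y = z + w" and e2: "i * x + j * y = k * z + l * w"
        using eq by (auto simp: f_def x_def y_def z_def w_def)
      have lt: "i < j" "k < l" "i < l" "k < j" using I12 in1 in2 by auto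
      have "\<exists>g. (g, k, l) \<in> J \<and> (c, c') \<in> G t g k l"
      \<comment> \<open>If the upper slopes differ, projecting along \<open>j\<close> kills one
        point of the second representation. If they agree, the lower slopes must differ, as
        otherwise both representations would be equal, and projecting along \<open>i\<close> does
        the same.\<close>
      proof (cases "j = l")
        case False
        have "(k - j) * z + (l - j) * w = (i - j) * x"
        proof -
          have "(k - j) * z + (l - j) * w - (i - j) * x
              = (k * z + l * w) - (i * x + j * y) - j * ((z + w) - (x + y))"
            by (simp add: algebra_simps)
          then show ?thesis using e1 e2 by simp
        qed
        then have "(k - j) * z + (l - j) * w \<in> Of t j"
          unfolding Of_def x_def using in2 subI by force
        then show ?thesis using False lt in1 in2 subI
          by (intro exI[of _ j]) (auto simp: J_def G_def z_def w_def)
      next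
        case True
        have "i \<noteq> k"
        proof
          assume ik: "i = k"
          have "(j - i) * (y - w) = (i * x + j * y) - (k * z + l * w) - i * ((x + y) - (z + w))"
            using ik True by (simp add: algebra_simps)
          then have "y = w" using e1 e2 lt by simp
          then have "x = z" using e1 by simp
          have "be t i \<noteq> 0" "be t j \<noteq> 0" using be(2)[OF _ t] in2 subI by (metis less_irrefl)+
          then have "d = c" "d' = c'"
            using \<open>x = z\<close> \<open>y = w\<close> ik True by (simp_all add: x_def y_def z_def w_def)
          then show False using ne ik True by simp
        qed
        have "(k - i) * z + (l - i) * w = (j - i) * y"
        proof -
          have "(k - i) * z + (l - i) * w - (j - i) * y
              = (k * z + l * w) - (i * x + j * y) - i * ((z + w) - (x + y))"
            by (simp add: algebra_simps)
          then show ?thesis using e1 e2 by simp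
        qed
        then have "(k - i) * z + (l - i) * w \<in> Of t i"
          unfolding Of_def y_def using in2 subI by force
        then show ?thesis using \<open>i \<noteq> k\<close> lt in1 in2 subI
          by (intro exI[of _ i]) (auto simp: J_def G_def z_def w_def)
      qed
      then show "r \<in> (\<lambda>((j, k, l), (c, c')). (k, l, c, c')) ` W"
        unfolding W_def r by force
    qed
    moreover have finW: "finite W" unfolding W_def using finJ finG by (auto split: prod.splits)
    ultimately have "card (NU t) \<le> card W"
      by (meson card_image_le card_mono finite_imageI le_trans)
    also have "card W = (\<Sum>(j, k, l)\<in>J. card (G t j k l))"
      unfolding W_def using finJ finG by (subst card_SigmaI) (auto split: prod.splits intro!: sum.cong)
    finally show ?thesis .
  qed
  have tot: "T * (h\<^sup>2 * n\<^sup>2) \<le> 2 * (\<Sum>(j, k, l)\<in>J. \<Sum>t<T. card (G t j k l))"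
  proof -
    have "T * (h\<^sup>2 * n\<^sup>2) = (\<Sum>t<T. h\<^sup>2 * n\<^sup>2)" by simp
    also have "\<dots> \<le> (\<Sum>t<T. 2 * (\<Sum>(j, k, l)\<in>J. card (G t j k l)))"
    proof (rule sum_mono)
      fix t assume "t \<in> {..<T}"
      then show "h\<^sup>2 * n\<^sup>2 \<le> 2 * (\<Sum>(j, k, l)\<in>J. card (G t j k l))"
        using NU[of t] NUle[of t] by simp
    qed
    also have "\<dots> = 2 * (\<Sum>t<T. \<Sum>r\<in>J. case r of (j, k, l) \<Rightarrow> card (G t j k l))"
      by (simp add: sum_distrib_left)
    also have "(\<Sum>t<T. \<Sum>r\<in>J. case r of (j, k, l) \<Rightarrow> card (G t j k l))
        = (\<Sum>r\<in>J. \<Sum>t<T. case r of (j, k, l) \<Rightarrow> card (G t j k l))" by (rule sum.swap)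
    also have "\<dots> = (\<Sum>(j, k, l)\<in>J. \<Sum>t<T. card (G t j k l))"
      by (intro sum.cong) (auto split: prod.splits)
    finally show ?thesis .
  qed
  \<comment> \<open>Averaging \<open>tot\<close> over the at most \<open>2 h^3\<close> triples of
    \<open>J\<close>.\<close>
  have "\<exists>j k l. (j, k, l) \<in> J \<and> T * n\<^sup>2 \<le> 4 * h * (\<Sum>t<T. card (G t j k l))"
  proof (rule ccontr)
    assume "\<not> ?thesis"
    then have less: "4 * h * (\<Sum>t<T. card (G t j k l)) < T * n\<^sup>2" if "(j, k, l) \<in> J" for j k l
      using that by (metis not_le)
    have Jne: "J \<noteq> {}"
    proof
      assume "J = {}"
      then show False using tot T0 I n0 by simp
    qed
    have "4 * h * (\<Sum>(j, k, l)\<in>J. \<Sum>t<T. card (G t j k l))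
        = (\<Sum>(j, k, l)\<in>J. 4 * h * (\<Sum>t<T. card (G t j k l)))"
      by (simp add: sum_distrib_left case_prod_unfold)
    also have "\<dots> < (\<Sum>r\<in>J. T * n\<^sup>2)"
      using less finJ Jne by (intro sum_strict_mono) auto
    also have "\<dots> = card J * (T * n\<^sup>2)" by simp
    also have "\<dots> \<le> 2 * h * h\<^sup>2 * (T * n\<^sup>2)" using cJ by (rule mult_le_mono1)
    finally have "2 * (\<Sum>(j, k, l)\<in>J. \<Sum>t<T. card (G t j k l)) * (2 * h) < T * (h\<^sup>2 * n\<^sup>2) * (2 * h)"
      by (simp add: algebra_simps)
    then show False using tot by (meson mult_less_cancel2 not_le)
  qed
  then obtain j k l where jkl: "(j, k, l) \<in> J"
    and rich: "T * n\<^sup>2 \<le> 4 * h * (\<Sum>t<T. card (G t j k l))" by blast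
  have kl: "j \<in> I" "k \<in> I1" "l \<in> I2" "j \<noteq> k" "j \<noteq> l" "l \<notin> I1" "k \<in> I" "l \<in> I"
    using jkl subI by (auto simp: J_def I2_def)
  \<comment> \<open>Solving the three-term relation for \<open>c'\<close> puts
    \<open>(c, c')\<close> on a line of slope \<open>m t\<close>.\<close>
  define A2 where "A2 = (l - j) * b l 0"
  define m where "m = (\<lambda>t. - ((k - j) * b k t) / A2)"
  have A2: "A2 \<noteq> 0" using kl bB(2)[of l 0] T0 by (simp add: A2_def)
  have m0: "m t \<noteq> 0" if "t < T" for t
    using kl bB(2)[of k t] that A2 by (simp add: m_def)
  have minj: "inj_on m {..<T}"
  proof (rule inj_onI)
    fix t t' assume tt: "t \<in> {..<T}" "t' \<in> {..<T}" "m t = m t'"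
    then have "b k t = b k t'" using A2 kl by (simp add: m_def)
    then show "t = t'" using b(1)[OF kl(7)] tt by (auto dest: inj_onD)
  qed
  \<comment> \<open>With this \<open>q\<close> and \<open>32 h^2 <= n\<close>, the two terms
    containing \<open>T\<close> in the final estimate are each at most a quarter of
    \<open>T n^2\<close>. The term from pairs in a cell is \<open>2^14 h^5 n^2\<close>, which leaves
    \<open>T <= 2^15 h^5\<close>.\<close>
  define q where "q = 64 * h\<^sup>2"
  define L where "L = (\<Union>t<T. {m t} \<times> (\<lambda>u. u / A2) ` Of t j)"
  have finO: "finite (Of t j)" for t unfolding Of_def using I C by auto
  have finL: "finite L" unfolding L_def using finO by auto
  have cL: "card L \<le> T * (2 * h * n)"
  proof -
    have "card L \<le> (\<Sum>t<T. card ({m t} \<times> (\<lambda>u. u / A2) ` Of t j))"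
      unfolding L_def by (rule card_UN_le) simp
    also have "\<dots> \<le> (\<Sum>t<T. 2 * h * n)"
    proof (rule sum_mono)
      fix t assume "t \<in> {..<T}"
      have "card ({m t} \<times> (\<lambda>u. u / A2) ` Of t j) = card ((\<lambda>u. u / A2) ` Of t j)"
        by (simp add: card_cartesian_product)
      also have "\<dots> \<le> card (Of t j)" using finO by (rule card_image_le)
      finally show "card ({m t} \<times> (\<lambda>u. u / A2) ` Of t j) \<le> 2 * h * n" using cO le_trans by blast
    qed
    finally show ?thesis by simp
  qed
  define Inc where "Inc = {(p, l). p \<in> C \<times> C \<and> l \<in> L \<and> snd p = fst l * fst p + snd l}"
  have "card Inc \<le> (2 * (card C div q) + 1) * card L + q\<^sup>2 * (card C)\<^sup>2"
    unfolding Inc_def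
  proof (rule grid_incidences)
    show "q > 0" using I by (simp add: q_def)
    fix mm kk assume "(mm, kk) \<in> L"
    then show "mm \<noteq> 0" using m0 by (auto simp: L_def)
  qed (use C finL in auto)
  then have Inc_le: "card Inc \<le> (2 * (n div q) + 1) * card L + q\<^sup>2 * n\<^sup>2" by (simp add: n_def)
  have sumG: "(\<Sum>t<T. card (G t j k l)) \<le> card Inc"
  proof -
    define code where "code = (\<lambda>(t, (c, c')). ((c, c'), (m t, ((k - j) * (b k t * c) + A2 * c') / A2)))"
    have "inj_on code (SIGMA t:{..<T}. G t j k l)"
    proof (rule inj_onI)
      fix a a' assume h: "a \<in> (SIGMA t:{..<T}. G t j k l)" "a' \<in> (SIGMA t:{..<T}. G t j k l)"
        "code a = code a'"
      obtain t c c' where a: "a = (t, (c, c'))" by (cases a) auto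
      obtain t1 c1 c1' where a1: "a' = (t1, (c1, c1'))" by (cases a') auto
      have "m t = m t1" "c = c1" "c' = c1'" using h(3) by (auto simp: code_def a a1)
      then show "a = a'" using minj h by (auto simp: a a1 dest: inj_onD)
    qed
    moreover have "code ` (SIGMA t:{..<T}. G t j k l) \<subseteq> Inc"
    proof
      fix z assume "z \<in> code ` (SIGMA t:{..<T}. G t j k l)"
      then obtain t c c' where t: "t < T" "(c, c') \<in> G t j k l" and z: "z = code (t, (c, c'))" by auto
      have inO: "(k - j) * (b k t * c) + A2 * c' \<in> Of t j" and cc: "c \<in> C" "c' \<in> C"
        using t(2) kl by (auto simp: G_def be_def A2_def mult.assoc)
      have "(m t, ((k - j) * (b k t * c) + A2 * c') / A2) \<in> L"
        unfolding L_def using t(1) inO by auto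
      moreover have "c' = m t * c + ((k - j) * (b k t * c) + A2 * c') / A2"
        using A2 by (simp add: m_def field_simps)
      ultimately show "z \<in> Inc" using cc by (simp add: Inc_def z code_def)
    qed
    moreover have "finite Inc"
      unfolding Inc_def by (rule finite_subset[of _ "(C \<times> C) \<times> L"]) (use C finL in auto)
    ultimately have "card (SIGMA t:{..<T}. G t j k l) \<le> card Inc" by (intro card_inj_on_le)
    then show ?thesis using finG by (subst (asm) card_SigmaI) auto
  qed
  have "real (n div q) \<le> real n / real q" by (rule of_nat_div_le_of_nat)
  then have ndq: "64 * (real h)\<^sup>2 * real (n div q) \<le> real n"
    using I by (simp add: q_def field_simps)
  have "T * n\<^sup>2 \<le> 4 * h * ((2 * (n div q) + 1) * (T * (2 * h * n)) + q\<^sup>2 * n\<^sup>2)"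
  proof -
    have "(\<Sum>t<T. card (G t j k l)) \<le> (2 * (n div q) + 1) * (T * (2 * h * n)) + q\<^sup>2 * n\<^sup>2"
      using sumG Inc_le mult_le_mono2[OF cL, of "2 * (n div q) + 1"] by linarith
    then show ?thesis using rich by (meson le_trans mult_le_mono2)
  qed
  then have "real (T * n\<^sup>2) \<le> real (4 * h * ((2 * (n div q) + 1) * (T * (2 * h * n)) + q\<^sup>2 * n\<^sup>2))"
    by (subst of_nat_le_iff)
  also have "\<dots> = (64 * (real h)\<^sup>2 * real (n div q)) * (real T * real n) / 4
      + 8 * (real h)\<^sup>2 * (real T * real n) + 2 ^ 14 * real h ^ 5 * (real n)\<^sup>2"
    by (simp add: q_def power2_eq_square algebra_simps power_numeral_reduce)
  also have "\<dots> \<le> real n * (real T * real n) / 4 + (real n / 4) * (real T * real n)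
      + 2 ^ 14 * real h ^ 5 * (real n)\<^sup>2"
  proof -
    have "real (32 * h\<^sup>2) \<le> real n" using C(3) by (subst of_nat_le_iff) (simp add: n_def)
    then have "8 * (real h)\<^sup>2 \<le> real n / 4" by simp
    then have "8 * (real h)\<^sup>2 * (real T * real n) \<le> (real n / 4) * (real T * real n)"
      by (rule mult_right_mono) simp
    moreover have "(64 * (real h)\<^sup>2 * real (n div q)) * (real T * real n) \<le> real n * (real T * real n)"
      using ndq by (rule mult_right_mono) simp
    ultimately show ?thesis by linarith
  qed
  finally have "real T * (real n)\<^sup>2 \<le> 2 ^ 15 * real h ^ 5 * (real n)\<^sup>2"
    by (simp add: power2_eq_square)
  then have "real T \<le> 2 ^ 15 * real h ^ 5" using n0 by simp
  then show False by (simp add: T_def)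
qed

text \<open>Blocks with \<open>h\<close> near \<open>t^(1/5) / 16\<close> are added up by
  \<open>sector_count\<close>. When \<open>t\<close> is too small for a block, pairs of lines
  suffice; when there are fewer than \<open>2 h\<close> slopes, \<open>cube\<close> does.\<close>

lemma rich_core_bound:
  fixes E C Z1 Z2 :: "real set" and B :: "real \<Rightarrow> real set" and t :: real
  assumes fin: "finite E" "finite Z1" "finite Z2" "finite C" and E0: "0 \<notin> E" and C: "C \<subseteq> {0<..}"
    and t: "t > 0"
    and B: "\<And>l. l \<in> E \<Longrightarrow> B l \<subseteq> {0<..}" "\<And>l. l \<in> E \<Longrightarrow> t \<le> card (B l)"
      "\<And>l. l \<in> E \<Longrightarrow> card (B l) \<le> card C"
    and sums: "\<And>l k a a' c c'. \<lbrakk>l \<in> E; k \<in> E; a \<in> B l; a' \<in> B k; c \<in> C; c' \<in> C\<rbrakk>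
      \<Longrightarrow> a * c + a' * c' \<in> Z1 \<and> l * (a * c) + k * (a' * c') \<in> Z2"
    and cube: "real (card C) ^ 3 \<le> 3 * (card Z1 * card Z2)"
  shows "card E * (real (card C))\<^sup>2 * t powr (1/5) \<le> 256 * (card Z1 * card Z2)"
proof (cases "E = {}")
  case False
  define n where "n = real (card C)"
  define S where "S = real (card Z1) * real (card Z2)"
  define u where "u = t powr (1/5)"
  have u5: "u ^ 5 = t" using t by (simp add: u_def powr_power)
  have u0: "u > 0" using t by (simp add: u_def)
  have n0: "n \<ge> 0" by (simp add: n_def)
  have S0: "S \<ge> 0" by (simp add: S_def)
  obtain l0 where l0: "l0 \<in> E" using False by blast
  have tn: "t \<le> n" using B(2,3)[OF l0] by (simp add: n_def)
  have "\<exists>a. a \<in> B l" if "l \<in> E" for l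
    using B(2)[OF that] t by (metis card.empty equals0I not_le of_nat_0)
  then obtain a where a: "\<And>l. l \<in> E \<Longrightarrow> a l \<in> B l" by metis
  have apos: "l \<in> E \<Longrightarrow> a l > 0" for l using a B(1) by auto
  have "card E * n\<^sup>2 \<le> 3 * (card Z1 * card Z2)"
  proof (rule lines_grid_bound[where Y = "\<lambda>l. (*) (a l) ` C"])
    fix l assume l: "l \<in> E"
    show "(*) (a l) ` C \<subseteq> {0<..}" using apos[OF l] C by auto
    have "card ((*) (a l) ` C) = card C"
      using apos[OF l] by (intro card_image inj_onI) auto
    then show "n \<le> card ((*) (a l) ` C)" by (simp add: n_def)
    show "finite ((*) (a l) ` C)" using fin by simp
  next
    fix l k x x' assume h: "l \<in> E" "k \<in> E" "x \<in> (*) (a l) ` C" "x' \<in> (*) (a k) ` C"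
    then show "x + x' \<in> Z1 \<and> l * x + k * x' \<in> Z2"
      using sums[OF h(1,2) a[OF h(1)] a[OF h(2)]] by auto
  qed (use fin E0 n0 in auto)
  then have base: "card E * n\<^sup>2 \<le> 3 * S" by (simp add: S_def)
  have "card E * n\<^sup>2 * u \<le> 256 * S"
  proof (cases "u < 16")
    case True
    have "card E * n\<^sup>2 * u \<le> card E * n\<^sup>2 * 16" using True by (intro mult_left_mono) auto
    also have "\<dots> \<le> 256 * S" using base S0 by linarith
    finally show ?thesis .
  next
    case False
    \<comment> \<open>Since \<open>16^5 = 2^20\<close>, this gives \<open>2^20 h^5 <= t\<close>,
      enough for both size conditions of \<open>block_sums_bound\<close>. Conversely
      \<open>u <= 32 h\<close>, so the block length is of order \<open>u\<close>.\<close>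
    define h where "h = nat \<lfloor>u / 16\<rfloor>"
    have h1: "h \<ge> 1" using False by (simp add: h_def le_nat_iff)
    have hle: "real h \<le> u / 16"
      unfolding h_def using u0 of_int_floor_le[of "u / 16"] by (simp del: of_int_floor_le)
    have hge: "u \<le> 32 * real h"
    proof -
      have "u / 16 < real h + 1" unfolding h_def using u0 by linarith
      then show ?thesis using h1 by linarith
    qed
    have "real h ^ 5 \<le> (u / 16) ^ 5" using hle by (intro power_mono) auto
    also have "\<dots> = t / 2 ^ 20" by (simp add: power_divide u5)
    finally have h5: "2 ^ 20 * real h ^ 5 \<le> t" by simp
    have h25: "real h ^ 2 \<le> real h ^ 5" using h1 by (intro power_increasing) auto
    have hn: "32 * h\<^sup>2 \<le> card C"
    proof -
      have "real h ^ 5 \<ge> 0" by simp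
      moreover have "1048576 * real h ^ 5 \<le> t" using h5 by simp
      ultimately have "32 * real h ^ 2 \<le> n" using h25 tn by linarith
      then have "real (32 * h\<^sup>2) \<le> real (card C)" by (simp add: n_def)
      then show ?thesis by (subst (asm) of_nat_le_iff)
    qed
    have hB: "2 ^ 15 * h ^ 5 < card (B l)" if "l \<in> E" for l
    proof -
      have "real h ^ 5 > 0" using h1 by simp
      moreover have "1048576 * real h ^ 5 \<le> t" using h5 by simp
      ultimately have "32768 * real h ^ 5 < real (card (B l))" using B(2)[OF that] by linarith
      then have "real (2 ^ 15 * h ^ 5) < real (card (B l))" by simp
      then show ?thesis by (subst (asm) of_nat_less_iff)
    qed
    show ?thesis
    proof (cases "card E < 2 * h")
      \<comment> \<open>Here \<open>card E <= u / 8\<close>, and \<open>u^2 <= u^5 = t <= n\<close>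
        reduces the claim to the bound on \<open>n^3\<close>.\<close>
      case True
      have "real (card E) \<le> u / 8" using True hle by linarith
      then have "card E * n\<^sup>2 * u \<le> (u / 8) * n\<^sup>2 * u"
        using u0 by (intro mult_right_mono) auto
      also have "\<dots> = (u\<^sup>2 / 8) * n\<^sup>2" by (simp add: power2_eq_square)
      also have "\<dots> \<le> (n / 8) * n\<^sup>2"
      proof (rule mult_right_mono)
        have "u\<^sup>2 \<le> u ^ 5" using False by (intro power_increasing) auto
        then show "u\<^sup>2 / 8 \<le> n / 8" using tn u5 by simp
      qed simp
      also have "\<dots> = n ^ 3 / 8" by (simp add: power3_eq_cube power2_eq_square)
      also have "\<dots> \<le> 256 * S"
      proof -
        have "n ^ 3 \<le> 3 * S" using cube by (simp add: n_def S_def)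
        then show ?thesis using S0 by linarith
      qed
      finally show ?thesis .
    next
      case False
      \<comment> \<open>Half of \<open>h^2 n^2\<close>, rounded up.\<close>
      define v where "v = (h\<^sup>2 * (card C)\<^sup>2 + 1) div 2"
      have "(card E div (2 * h)) * v \<le> card (Z1 \<times> Z2)"
      proof (rule sector_count)
        fix I assume I: "I \<subseteq> E" "card I = 2 * h"
        have "h\<^sup>2 * (card C)\<^sup>2 \<le> 2 * card {z \<in> Z1 \<times> Z2. fst z > 0 \<and>
            (\<exists>a\<in>I. a * fst z < snd z) \<and> (\<exists>b\<in>I. snd z < b * fst z)}"
        proof (rule block_sums_bound[where B = B])
          show "finite I" using I fin finite_subset by blast
          fix l k a a' c c'
          assume "l \<in> I" "k \<in> I" "a \<in> B l" "a' \<in> B k" "c \<in> C" "c' \<in> C"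
          then have "a * c + a' * c' \<in> Z1 \<and> l * (a * c) + k * (a' * c') \<in> Z2"
            using I(1) by (intro sums) auto
          then show "(a * c + a' * c', l * (a * c) + k * (a' * c')) \<in> Z1 \<times> Z2" by simp
        qed (use I h1 fin C hn B(1) hB in \<open>auto simp: subset_iff\<close>)
        then show "v \<le> card {z \<in> Z1 \<times> Z2. fst z > 0 \<and>
            (\<exists>a\<in>I. a * fst z < snd z) \<and> (\<exists>b\<in>I. snd z < b * fst z)}"
          unfolding v_def by linarith
      qed (use fin h1 in auto)
      then have main: "real (card E div (2 * h)) * real v \<le> S"
        unfolding S_def by (metis card_cartesian_product of_nat_le_iff of_nat_mult)
      define d where "d = card E div (2 * h)"
      have d1: "d \<ge> 1" using False h1 by (simp add: d_def div_greater_zero_iff Suc_le_eq)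
      have "card E < 2 * h * (d + 1)"
        using h1 dividend_less_div_times[of "2 * h" "card E"] by (simp add: d_def algebra_simps)
      moreover have "2 * h * (d + 1) \<le> 2 * h * (2 * d)" using d1 by (intro mult_le_mono2) simp
      moreover have "2 * h * (2 * d) = 4 * h * d" by simp
      ultimately have "card E \<le> 4 * h * d" by linarith
      then have cE: "real (card E) \<le> 4 * real h * real d"
        by (metis of_nat_le_iff of_nat_mult of_nat_numeral)
      have "h\<^sup>2 * (card C)\<^sup>2 \<le> 2 * v" unfolding v_def by linarith
      then have "real (h\<^sup>2 * (card C)\<^sup>2) \<le> real (2 * v)" by (subst of_nat_le_iff)
      then have vge: "(real h)\<^sup>2 * n\<^sup>2 \<le> 2 * real v" by (simp add: n_def)
      have "card E * n\<^sup>2 * u \<le> (4 * real h * real d) * n\<^sup>2 * (32 * real h)"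
        using cE hge u0 by (intro mult_mono) auto
      also have "\<dots> = 128 * real d * ((real h)\<^sup>2 * n\<^sup>2)" by (simp add: power2_eq_square)
      also have "\<dots> \<le> 128 * real d * (2 * real v)" using vge by (intro mult_left_mono) auto
      also have "\<dots> = 256 * (real d * real v)" by simp
      also have "\<dots> \<le> 256 * S" using main by (simp add: d_def)
      finally show ?thesis .
    qed
  qed
  then show ?thesis by (simp add: n_def u_def S_def)
qed auto

section \<open>Level sets and interpolation\<close>

text \<open>Values below \<open>F / (2 R)\<close> account for at most half of the total
  \<open>F\<close>. The dyadic levels above contribute a geometric series because \<sigma> > 1, so
  no logarithm is lost.\<close>

lemma weak_type_sum:
  fixes f :: "'a \<Rightarrow> nat" and K \<sigma> R :: real
  assumes fin: "finite D" and \<sigma>: "\<sigma> > 1" and R: "R > 0" "card D \<le> R" and K: "K \<ge> 0"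
    and weak: "\<And>y::real. y > 0 \<Longrightarrow> card {x \<in> D. y \<le> f x} * y powr \<sigma> \<le> K"
  shows "real (\<Sum>x\<in>D. f x) powr \<sigma> \<le> 2 / (1 - 2 powr (1 - \<sigma>)) * K * (2 * R) powr (\<sigma> - 1)"
proof -
  define F where "F = real (\<Sum>x\<in>D. f x)"
  define r where "r = (2::real) powr (1 - \<sigma>)"
  have r: "0 < r" "r < 1" using \<sigma> by (simp_all add: r_def powr_less_one)
  have rhs0: "0 \<le> 2 / (1 - r) * K * (2 * R) powr (\<sigma> - 1)" using r K by simp
  show ?thesis
  proof (cases "F = 0")
    case True
    then have "real (\<Sum>x\<in>D. f x) powr \<sigma> = 0" using \<sigma> by (simp only: F_def[symmetric]) simp
    then show ?thesis using rhs0 by (simp only: r_def)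
  next
    case False
    moreover have "F \<ge> 0" by (simp add: F_def sum_nonneg)
    ultimately have F: "F > 0" by simp
    define v where "v = F / (2 * R)"
    have v: "v > 0" using F R by (simp add: v_def)
    obtain N where N: "F < v * 2 ^ N"
      using real_arch_pow[of 2 "F / v"] v by (auto simp: field_simps)
    have fN: "real (f x) < v * 2 ^ N" if "x \<in> D" for x
    proof -
      have "f x \<le> (\<Sum>x\<in>D. f x)" using that fin by (intro member_le_sum) auto
      then have "real (f x) \<le> F" unfolding F_def by (subst of_nat_le_iff)
      then show ?thesis using N by linarith
    qed
    \<comment> \<open>The thresholds up to the last one reached, together with \<open>v\<close>, sum
      to the next threshold, which exceeds \<open>s\<close>.\<close>
    have layer: "s \<le> v + (\<Sum>i<M. if v * 2 ^ i \<le> s then v * 2 ^ i else 0)"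
      if "s < v * 2 ^ M" for s :: real and M
      using that
    proof (induction M)
      case (Suc M)
      show ?case
      proof (cases "s < v * 2 ^ M")
        case True
        then show ?thesis using Suc.IH v by simp
      next
        case False
        have "v * 2 ^ i \<le> s" if "i < Suc M" for i
        proof -
          have "(2::real) ^ i \<le> 2 ^ M" using that by (intro power_increasing) auto
          then have "v * 2 ^ i \<le> v * 2 ^ M" using v by simp
          then show ?thesis using False by linarith
        qed
        then have "(\<Sum>i<Suc M. if v * 2 ^ i \<le> s then v * 2 ^ i else 0) = (\<Sum>i<Suc M. v * 2 ^ i)"
          by (intro sum.cong) auto
        also have "\<dots> = v * (\<Sum>i<Suc M. 2 ^ i)" by (simp only: sum_distrib_left)
        also have "(\<Sum>i<Suc M. 2 ^ i) = (2::real) ^ Suc M - 1"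
          using geometric_sum[of "2::real" "Suc M"] by simp
        finally show ?thesis using Suc.prems by (simp add: algebra_simps)
      qed
    qed simp
    have "F = (\<Sum>x\<in>D. real (f x))" by (simp add: F_def)
    also have "\<dots> \<le> (\<Sum>x\<in>D. v + (\<Sum>i<N. if v * 2 ^ i \<le> real (f x) then v * 2 ^ i else 0))"
      by (intro sum_mono layer fN)
    also have "\<dots> = card D * v + (\<Sum>i<N. \<Sum>x\<in>D. if v * 2 ^ i \<le> real (f x) then v * 2 ^ i else 0)"
      by (simp add: sum.distrib sum.swap[of _ D])
    also have "\<dots> \<le> R * v + (\<Sum>i<N. K * v powr (1 - \<sigma>) * r ^ i)"
    proof (intro add_mono sum_mono mult_right_mono)
      fix i
      define y where "y = v * 2 ^ i"
      have y: "y > 0" using v by (simp add: y_def)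
      have "(\<Sum>x\<in>D. if y \<le> real (f x) then y else 0) = card {x \<in> D. y \<le> f x} * y"
        using fin by (simp add: sum.If_cases Int_def)
      also have "\<dots> = card {x \<in> D. y \<le> f x} * y powr \<sigma> * y powr (1 - \<sigma>)"
        using y by (simp add: mult.assoc flip: powr_add)
      also have "\<dots> \<le> K * y powr (1 - \<sigma>)" using weak[OF y] by (rule mult_right_mono) simp
      also have "y powr (1 - \<sigma>) = v powr (1 - \<sigma>) * r ^ i"
      proof -
        have "((2::real) ^ i) powr (1 - \<sigma>) = r ^ i"
          by (simp add: r_def powr_realpow[symmetric] powr_powr mult.commute)
        then show ?thesis using v by (simp add: y_def powr_mult)
      qed
      finally show "(\<Sum>x\<in>D. if v * 2 ^ i \<le> real (f x) then v * 2 ^ i else 0) \<le> K * v powr (1 - \<sigma>) * r ^ i"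
        by (simp only: y_def mult.assoc)
    qed (use R v in auto)
    also have "\<dots> = F / 2 + K * v powr (1 - \<sigma>) * (\<Sum>i<N. r ^ i)"
      using R by (simp add: v_def sum_distrib_left)
    also have "\<dots> \<le> F / 2 + K * v powr (1 - \<sigma>) * (1 / (1 - r))"
    proof (intro add_left_mono mult_left_mono)
      have "(\<Sum>i<N. r ^ i) = (1 - r ^ N) / (1 - r)"
        using r by (simp add: sum_gp_strict)
      also have "\<dots> \<le> 1 / (1 - r)" using r by (intro divide_right_mono) auto
      finally show "(\<Sum>i<N. r ^ i) \<le> 1 / (1 - r)" .
    qed (use K in auto)
    finally have FK: "F \<le> 2 / (1 - r) * K * v powr (1 - \<sigma>)" by simp
    have "F powr \<sigma> = F * F powr (\<sigma> - 1)" using F by (simp add: powr_diff)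
    also have "\<dots> \<le> 2 / (1 - r) * K * v powr (1 - \<sigma>) * F powr (\<sigma> - 1)"
      using FK by (rule mult_right_mono) simp
    also have "v powr (1 - \<sigma>) * F powr (\<sigma> - 1) = (2 * R) powr (\<sigma> - 1)"
    proof -
      have "v powr (1 - \<sigma>) = F powr (1 - \<sigma>) / (2 * R) powr (1 - \<sigma>)"
        unfolding v_def using F R by (simp add: powr_divide)
      also have "\<dots> = F powr (1 - \<sigma>) * (2 * R) powr (\<sigma> - 1)"
        using powr_minus_divide[of "2 * R" "1 - \<sigma>"] by simp
      finally show ?thesis using F by (simp flip: powr_add)
    qed
    then have "2 / (1 - r) * K * v powr (1 - \<sigma>) * F powr (\<sigma> - 1) = 2 / (1 - r) * K * (2 * R) powr (\<sigma> - 1)"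
      by (simp add: mult.assoc)
    finally show ?thesis by (simp add: F_def r_def)
  qed
qed

text \<open>A weighted geometric mean of the two bounds, with weights 351/551 and 200/551. The first
  exceeds 1/2, so the exponent of \<open>y\<close> exceeds 1 as \<open>weak_type_sum\<close>
  demands, and it is tuned to yield the exponent 38/29 in \<open>prods_bound\<close>.\<close>

lemma interpolate_card_bounds:
  fixes E y N t S :: real
  assumes E: "E \<ge> 0" and y: "y > 0" and N: "N > 0" and t: "t > 0"
    and b1: "E * y\<^sup>2 \<le> 512 * S" and b2: "E * N\<^sup>2 * t powr (1/5) \<le> 512 * S"
  shows "E * y powr (702/551) \<le> 512 * S / (N powr (400/551) * t powr (40/551))"
proof (cases "E = 0")
  case True
  have "0 \<le> 512 * S" using b1 True by simp
  then show ?thesis using True by simp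
next
  case False
  then have E: "E > 0" using E by simp
  have S: "512 * S > 0" using b1 E y by (meson less_le_trans mult_pos_pos zero_less_power)
  have "E * y powr (702/551) * (N powr (400/551) * t powr (40/551))
      = (E * y\<^sup>2) powr (351/551) * (E * N\<^sup>2 * t powr (1/5)) powr (200/551)"
  proof -
    have sq: "(x\<^sup>2) powr a = x powr (2 * a)" if "x > 0" for x a :: real
    proof -
      have "(x\<^sup>2) powr a = (x powr 2) powr a" using that by simp
      also have "\<dots> = x powr (2 * a)" by (rule powr_powr)
      finally show ?thesis .
    qed
    have EE: "E powr (351/551) * E powr (200/551) = E" using E by (simp flip: powr_add)
    have p1: "(E * y\<^sup>2) powr (351/551) = E powr (351/551) * y powr (702/551)"
      using E y by (simp add: powr_mult sq)
    have p2: "(E * N\<^sup>2 * t powr (1/5)) powr (200/551)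
        = E powr (200/551) * (N powr (400/551) * t powr (40/551))"
      using E N t by (simp add: powr_mult powr_powr sq)
    have "(E * y\<^sup>2) powr (351/551) * (E * N\<^sup>2 * t powr (1/5)) powr (200/551)
        = (E powr (351/551) * E powr (200/551)) * (y powr (702/551) * (N powr (400/551) * t powr (40/551)))"
      unfolding p1 p2 by (simp only: mult_ac)
    then show ?thesis unfolding EE by (simp only: mult_ac)
  qed
  also have "\<dots> \<le> (512 * S) powr (351/551) * (512 * S) powr (200/551)"
    using E y N t by (intro mult_mono[OF powr_mono2[OF _ _ b1] powr_mono2[OF _ _ b2]]) auto
  also have "\<dots> = 512 * S" using S by (simp flip: powr_add)
  finally show ?thesis using N t by (simp add: pos_le_divide_eq)
qed

section \<open>Popular slopes and good factors\<close>

lemma card_sgn_image: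
  fixes X :: "real set"
  assumes "e = 1 \<or> e = - 1"
  shows "card ((*) e ` X) = card X"
  using assms by (intro card_image inj_onI) auto

text \<open>An \<open>a\<close> with \<open>l a\<close> positive has the sign of \<open>l\<close>.
  Multiplying by \<open>e\<close> makes these elements positive, so \<open>rich_core_bound\<close>
  applies to each sign of slopes separately, and its constant doubles to 512.\<close>

lemma popular_slopes_bound:
  fixes P C S Q E :: "real set" and t :: real
  assumes P: "finite P" "P \<subseteq> {0<..}" and Q: "finite Q"
    and S: "finite S" and t: "t > 0" and C: "finite C" "C \<subseteq> {0<..}" "card C = card P"
    and core: "\<And>l a c. a \<in> S \<Longrightarrow> l * a \<in> P \<Longrightarrow> c \<in> C \<Longrightarrow> a * c \<in> Q \<and> l * (a * c) \<in> Q"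
    and cube: "real (card P) ^ 3 \<le> 3 * (real (card (Q + Q)))\<^sup>2"
    and E: "finite E" "\<And>l. l \<in> E \<Longrightarrow> t \<le> card {a \<in> S. l * a \<in> P}"
  shows "card E * (real (card P))\<^sup>2 * t powr (1/5) \<le> 512 * (real (card (Q + Q)))\<^sup>2"
proof -
  have E0: "0 \<notin> E"
  proof
    assume "0 \<in> E"
    then have "t \<le> card {a \<in> S. 0 * a \<in> P}" by (rule E(2))
    moreover have "{a \<in> S. 0 * a \<in> P} = {}" using P by auto
    ultimately show False using t by (metis card.empty not_le of_nat_0)
  qed
  have half: "card {l \<in> E. e * l > 0} * (real (card P))\<^sup>2 * t powr (1/5) \<le> 256 * (real (card (Q + Q)))\<^sup>2"
    if e: "e = 1 \<or> e = - 1" for e :: real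
  proof -
    define Ee where "Ee = {l \<in> E. e * l > 0}"
    define Z where "Z = (*) e ` (Q + Q)"
    define B where "B = (\<lambda>l. (*) e ` {a \<in> S. l * a \<in> P})"
    have cZ: "card Z = card (Q + Q)" unfolding Z_def by (rule card_sgn_image[OF e])
    have ee: "e * e = 1" using e by auto
    have "card Ee * (real (card C))\<^sup>2 * t powr (1/5) \<le> 256 * (card Z * card Z)"
    proof (rule rich_core_bound[where B = B])
      fix l assume l: "l \<in> Ee"
      then have lE: "l \<in> E" "e * l > 0" by (auto simp: Ee_def)
      show "B l \<subseteq> {0<..}"
      proof
        fix x assume "x \<in> B l"
        then obtain a where a: "x = e * a" "l * a > 0" using P by (auto simp: B_def)
        have "(e * l) * x = (e * e) * (l * a)" by (simp add: a)
        also have "\<dots> = l * a" by (simp add: ee)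
        finally have "(e * l) * x = l * a" .
        then have "(e * l) * x > 0" using a(2) by metis
        then show "x \<in> {0<..}" using lE by (simp add: zero_less_mult_iff)
      qed
      show "t \<le> card (B l)" unfolding B_def card_sgn_image[OF e] by (rule E(2)[OF lE(1)])
      have "card {a \<in> S. l * a \<in> P} \<le> card P"
        using P E0 lE by (intro card_inj_on_le[where f = "(*) l"]) (auto intro!: inj_onI)
      then show "card (B l) \<le> card C" unfolding B_def card_sgn_image[OF e] C(3) .
    next
      fix l k x x' c c'
      assume "l \<in> Ee" "k \<in> Ee" "x \<in> B l" "x' \<in> B k" and c: "c \<in> C" "c' \<in> C"
      then obtain a a' where a: "x = e * a" "a \<in> S" "l * a \<in> P" "x' = e * a'" "a' \<in> S" "k * a' \<in> P"
        by (auto simp: B_def)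
      have "a * c + a' * c' \<in> Q + Q" "l * (a * c) + k * (a' * c') \<in> Q + Q"
        using core[OF a(2,3) c(1)] core[OF a(5,6) c(2)] by (auto intro!: set_plus_intro)
      moreover have "x * c + x' * c' = e * (a * c + a' * c')"
        "l * (x * c) + k * (x' * c') = e * (l * (a * c) + k * (a' * c'))"
        by (simp_all add: a algebra_simps)
      ultimately show "x * c + x' * c' \<in> Z \<and> l * (x * c) + k * (x' * c') \<in> Z"
        unfolding Z_def by (metis imageI)
    next
      show "real (card C) ^ 3 \<le> 3 * (card Z * card Z)"
        unfolding cZ C(3) using cube by (simp add: power2_eq_square)
      show "finite Z" unfolding Z_def using Q by (simp add: finite_set_plus)
      then show "finite Z" .
    qed (use E E0 t C in \<open>auto simp: Ee_def\<close>)
    then show ?thesis by (simp add: cZ C(3) Ee_def power2_eq_square)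
  qed
  have "E = {l \<in> E. 1 * l > 0} \<union> {l \<in> E. - 1 * l > 0}"
    using E0 by (auto simp: not_less order_le_less)
  then have "card E \<le> card {l \<in> E. 1 * l > 0} + card {l \<in> E. - 1 * l > 0}"
    by (metis card_Un_le)
  then have "real (card E) \<le> card {l \<in> E. 1 * l > 0} + card {l \<in> E. - 1 * l > 0}"
    by (metis of_nat_add of_nat_le_iff)
  then have "card E * ((real (card P))\<^sup>2 * t powr (1/5))
      \<le> (card {l \<in> E. 1 * l > 0} + card {l \<in> E. - 1 * l > 0}) * ((real (card P))\<^sup>2 * t powr (1/5))"
    by (intro mult_right_mono) auto
  also have "\<dots> \<le> 512 * (real (card (Q + Q)))\<^sup>2"
    using half[of 1] half[of "- 1"] by (simp add: algebra_simps)
  finally show ?thesis by (simp add: mult.assoc)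
qed

text \<open>Pairs \<open>(q, b)\<close> with \<open>b / g q\<close> popular are grouped by slope. By
  \<open>good\<close> they are at least half of all pairs, while the level sets of the multiplicity
  \<open>f\<close> obey both the bound from pairs of lines and the one from popularity. The map
  \<phi> lets popularity be measured at \<open>b / g q\<close> although the point over
  \<open>q\<close> lies on the line of slope \<open>\<phi> (b / g q)\<close>.\<close>

lemma good_part_bound:
  fixes P C S Q G Lam :: "real set" and g \<phi> :: "real \<Rightarrow> real" and t R e :: real
  assumes P: "finite P" "P \<subseteq> {0<..}" "P \<noteq> {}" and Q: "finite Q"
    and S: "finite S" and t: "t > 0" and C: "finite C" "C \<subseteq> {0<..}" "card C = card P"
    and core: "\<And>l a c. a \<in> S \<Longrightarrow> l * a \<in> P \<Longrightarrow> c \<in> C \<Longrightarrow> a * c \<in> Q \<and> l * (a * c) \<in> Q"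
    and cube: "real (card P) ^ 3 \<le> 3 * (real (card (Q + Q)))\<^sup>2"
    and Lam: "finite Lam" "card Lam \<le> R" "R > 0" "\<And>q b. q \<in> G \<Longrightarrow> b \<in> P \<Longrightarrow> b / g q \<in> Lam"
    and \<phi>: "inj \<phi>" "\<phi> 0 = 0"
    and e: "e = 1 \<or> e = - 1" and G: "G \<subseteq> Q" "\<And>q. q \<in> G \<Longrightarrow> e * q > 0" "\<And>q. q \<in> G \<Longrightarrow> g q \<noteq> 0"
    and pts: "\<And>q b. q \<in> G \<Longrightarrow> b \<in> P \<Longrightarrow> \<phi> (b / g q) * q \<in> Q"
    and good: "\<And>q. q \<in> G \<Longrightarrow> card P \<le> 2 * card {b \<in> P. t \<le> card {a \<in> S. b / g q * a \<in> P}}"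
  shows "(card G * real (card P) / 2) powr (702/551)
    \<le> 2 / (1 - 2 powr (- 151/551)) * (512 * (real (card (Q + Q)))\<^sup>2
        / (real (card P) powr (400/551) * t powr (40/551))) * (2 * R) powr (151/551)"
proof -
  define s where "s = real (card (Q + Q))"
  define N where "N = real (card P)"
  define D where "D = {l \<in> Lam. t \<le> card {a \<in> S. l * a \<in> P}}"
  define f where "f = (\<lambda>l. card {q \<in> G. l * g q \<in> P})"
  define K where "K = 512 * s\<^sup>2 / (N powr (400/551) * t powr (40/551))"
  have N0: "N > 0" using P by (simp add: N_def card_gt_0_iff)
  have finG: "finite G" using G Q finite_subset by blast
  have finD: "finite D" using Lam by (simp add: D_def)
  have weak: "card {l \<in> D. y \<le> f l} * y powr (702/551) \<le> K" if y: "y > 0" for y :: real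
  proof -
    define E where "E = {l \<in> D. y \<le> f l}"
    define E' where "E' = \<phi> ` E"
    \<comment> \<open>Indexed by the actual slope \<open>\<phi> l\<close>, as
      \<open>lines_grid_bound\<close> requires; injectivity of \<phi> translates back in
      \<open>YE\<close>.\<close>
    define Y where "Y = (\<lambda>l'. (*) e ` {q \<in> G. \<exists>b\<in>P. \<phi> (b / g q) = l'})"
    define Z where "Z = (*) e ` (Q + Q)"
    have cZ: "card Z = card (Q + Q)" unfolding Z_def by (rule card_sgn_image[OF e])
    have finE: "finite E" using finD by (simp add: E_def)
    have pop: "l \<in> E \<Longrightarrow> t \<le> card {a \<in> S. l * a \<in> P}" for l by (simp add: E_def D_def)
    have b2: "card E * N\<^sup>2 * t powr (1/5) \<le> 512 * s\<^sup>2"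
      unfolding N_def s_def
      by (rule popular_slopes_bound[OF P(1,2) Q S t C _ cube finE]) (use core pop in auto)
    have E0: "0 \<notin> E"
    proof
      assume "0 \<in> E"
      then have "t \<le> card {a \<in> S. 0 * a \<in> P}" by (rule pop)
      moreover have "{a \<in> S. 0 * a \<in> P} = {}" using P by auto
      ultimately show False using t by (metis card.empty not_le of_nat_0)
    qed
    have YE: "Y (\<phi> l) = (*) e ` {q \<in> G. l * g q \<in> P}" for l
    proof -
      have "(\<exists>b\<in>P. \<phi> (b / g q) = \<phi> l) \<longleftrightarrow> l * g q \<in> P" if "q \<in> G" for q
      proof -
        have "\<phi> (b / g q) = \<phi> l \<longleftrightarrow> b = l * g q" for b
          using \<phi>(1) G(3)[OF that] by (auto simp: inj_eq field_simps)
        then show ?thesis by auto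
      qed
      then show ?thesis unfolding Y_def by (auto intro!: arg_cong[where f = "\<lambda>X. (*) e ` X"])
    qed
    have "card E' * y\<^sup>2 \<le> 3 * (card Z * card Z)"
    proof (rule lines_grid_bound[where Y = Y])
      show "0 \<notin> E'"
      proof
        assume "0 \<in> E'"
        then obtain l where "l \<in> E" "\<phi> l = \<phi> 0" using \<phi>(2) by (auto simp: E'_def)
        then show False using E0 \<phi>(1) by (metis injD)
      qed
      fix l' assume "l' \<in> E'"
      then obtain l where l: "l \<in> E" "l' = \<phi> l" by (auto simp: E'_def)
      show "Y l' \<subseteq> {0<..}" using G(2) by (auto simp: Y_def)
      show "y \<le> card (Y l')"
        unfolding l(2) YE card_sgn_image[OF e] using l(1) by (simp add: E_def f_def)
      show "finite (Y l')" using finG by (simp add: Y_def)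
    next
      fix l k x x' assume h: "l \<in> E'" "k \<in> E'" "x \<in> Y l" "x' \<in> Y k"
      then obtain q b q' b' where q: "x = e * q" "q \<in> G" "b \<in> P" "\<phi> (b / g q) = l"
        and q': "x' = e * q'" "q' \<in> G" "b' \<in> P" "\<phi> (b' / g q') = k"
        by (auto simp: Y_def)
      have "q + q' \<in> Q + Q" "l * q + k * q' \<in> Q + Q"
        using pts[OF q(2,3)] pts[OF q'(2,3)] q q' G(1) by (auto intro!: set_plus_intro)
      moreover have "x + x' = e * (q + q')" "l * x + k * x' = e * (l * q + k * q')"
        by (simp_all add: q q' algebra_simps)
      ultimately show "x + x' \<in> Z \<and> l * x + k * x' \<in> Z" unfolding Z_def by (metis imageI)
    qed (use finE y Q in \<open>auto simp: E'_def Z_def finite_set_plus\<close>)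
    moreover have "card E' = card E"
      unfolding E'_def using \<phi>(1) by (intro card_image) (rule inj_on_subset, auto)
    ultimately have "card E * y\<^sup>2 \<le> 3 * s\<^sup>2" by (simp add: cZ s_def power2_eq_square)
    then have b1: "card E * y\<^sup>2 \<le> 512 * s\<^sup>2" using zero_le_power2[of s] by linarith
    show ?thesis unfolding K_def E_def[symmetric]
      by (rule interpolate_card_bounds[OF _ y N0 t b1 b2]) simp
  qed
  have "real (\<Sum>l\<in>D. f l) powr (702/551) \<le> 2 / (1 - 2 powr (1 - 702/551)) * K * (2 * R) powr (702/551 - 1)"
  proof (rule weak_type_sum)
    have "card D \<le> card Lam" using Lam by (intro card_mono) (auto simp: D_def)
    then show "card D \<le> R" using Lam(2) by linarith
    show "K \<ge> 0" by (simp add: K_def)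
  qed (use finD Lam weak in auto)
  \<comment> \<open>Double counting: \<open>(q, b)\<close> can be recovered from the slope
    \<open>b / g q\<close> together with \<open>q\<close>.\<close>
  moreover have "card G * N / 2 \<le> real (\<Sum>l\<in>D. f l)"
  proof -
    define X where "X = (\<lambda>q. {b \<in> P. t \<le> card {a \<in> S. b / g q * a \<in> P}})"
    have "card G * card P = (\<Sum>q\<in>G. card P)" by simp
    also have "\<dots> \<le> (\<Sum>q\<in>G. 2 * card (X q))" using good by (intro sum_mono) (simp add: X_def)
    also have "\<dots> = 2 * card (SIGMA q:G. X q)"
      using finG P by (subst card_SigmaI) (auto simp: X_def sum_distrib_left)
    also have "card (SIGMA q:G. X q) \<le> card (SIGMA l:D. {q \<in> G. l * g q \<in> P})"
    proof (rule card_inj_on_le[where f = "\<lambda>(q, b). (b / g q, q)"])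
      show "inj_on (\<lambda>(q, b). (b / g q, q)) (SIGMA q:G. X q)"
        using G(3) by (auto intro!: inj_onI)
      show "(\<lambda>(q, b). (b / g q, q)) ` (SIGMA q:G. X q) \<subseteq> (SIGMA l:D. {q \<in> G. l * g q \<in> P})"
        using G(3) Lam(4) by (auto simp: X_def D_def)
      show "finite (SIGMA l:D. {q \<in> G. l * g q \<in> P})" using finD finG by auto
    qed
    also have "card (SIGMA l:D. {q \<in> G. l * g q \<in> P}) = (\<Sum>l\<in>D. f l)"
      using finD finG by (subst card_SigmaI) (auto simp: f_def)
    finally have "card G * card P \<le> 2 * (\<Sum>l\<in>D. f l)" by simp
    then have "real (card G * card P) \<le> real (2 * (\<Sum>l\<in>D. f l))" by (subst of_nat_le_iff)
    then show ?thesis by (simp add: N_def)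
  qed
  then have "(card G * N / 2) powr (702/551) \<le> real (\<Sum>l\<in>D. f l) powr (702/551)"
    using N0 by (intro powr_mono2) auto
  ultimately show ?thesis by (simp add: K_def N_def s_def)
qed

section \<open>Iteration over the bad elements\<close>

text \<open>Each step shrinks the set by \<delta>, so the error terms at least double and their sum
  is governed by the last one, incurred at a size still above \<open>M\<close>. From size
  \<open>M\<close> downwards the trivial bound takes over.\<close>

lemma descent_bound:
  fixes F :: "'a set \<Rightarrow> nat" and K \<beta> \<delta> M :: real
  assumes K: "K > 0" and \<beta>: "\<beta> > 0" and \<delta>: "0 < \<delta>" "\<delta> < 1" "\<delta> powr (- \<beta>) \<ge> 2" and M: "M > 0"
    and fin: "finite A" and triv: "\<And>S. S \<subseteq> A \<Longrightarrow> F S \<le> (card S)\<^sup>2"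
    and step: "\<And>S. S \<subseteq> A \<Longrightarrow> S \<noteq> {} \<Longrightarrow>
      \<exists>S'\<subseteq>S. card S' \<le> \<delta> * card S \<and> F S \<le> 4 * K * card S powr (- \<beta>) + F S'"
  shows "F A \<le> M\<^sup>2 + 8 * K * M powr (- \<beta>)"
proof -
  have small: "F S \<le> M\<^sup>2" if "S \<subseteq> A" "card S \<le> M" for S
  proof -
    have "real (F S) \<le> real ((card S)\<^sup>2)" using triv[OF that(1)] by (subst of_nat_le_iff)
    also have "\<dots> = (real (card S))\<^sup>2" by simp
    also have "\<dots> \<le> M\<^sup>2" using that(2) by (intro power_mono) auto
    finally show ?thesis .
  qed
  \<comment> \<open>The subtracted term strengthens the induction: for \<open>S'\<close> it is at
    least twice as large as for \<open>S\<close>, which pays for the error of the step and restores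
    the term for \<open>S\<close>.\<close>
  have "F S \<le> M\<^sup>2 + 8 * K * M powr (- \<beta>) - 4 * K * card S powr (- \<beta>)"
    if "S \<subseteq> A" "M < card S" for S
    using that
  proof (induction "card S" arbitrary: S rule: less_induct)
    case less
    define k where "k = real (card S)"
    have k: "k > M" "k > 0" using less.prems M by (auto simp: k_def)
    then have "S \<noteq> {}" by (auto simp: k_def)
    then obtain S' where S': "S' \<subseteq> S" "card S' \<le> \<delta> * k" "F S \<le> 4 * K * k powr (- \<beta>) + F S'"
      using step[OF less.prems(1)] by (auto simp: k_def)
    have kM: "k powr (- \<beta>) \<le> M powr (- \<beta>)" using k M \<beta> by (intro powr_mono2') auto
    show ?case
    proof (cases "card S' \<le> M")
      case True
      then have "F S' \<le> M\<^sup>2" using small S' less.prems by auto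
      moreover have "8 * K * k powr (- \<beta>) \<le> 8 * K * M powr (- \<beta>)"
        using kM K by (intro mult_left_mono) auto
      ultimately show ?thesis using S'(3) unfolding k_def by linarith
    next
      case False
      define k' where "k' = real (card S')"
      have k': "k' > 0" using False M by (simp add: k'_def)
      have "\<delta> * k < 1 * k" using \<delta> k by (intro mult_strict_right_mono) auto
      then have "card S' < card S" using S'(2) by (simp add: k_def)
      then have IH: "F S' \<le> M\<^sup>2 + 8 * K * M powr (- \<beta>) - 4 * K * k' powr (- \<beta>)"
        unfolding k'_def using False S'(1) less.prems(1) by (intro less.hyps) auto
      have "2 * k powr (- \<beta>) \<le> \<delta> powr (- \<beta>) * k powr (- \<beta>)"
        using \<delta>(3) by (intro mult_right_mono) auto
      also have "\<dots> = (\<delta> * k) powr (- \<beta>)" using \<delta> k by (simp add: powr_mult)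
      also have "\<dots> \<le> k' powr (- \<beta>)"
        using S'(2) k' \<beta> by (intro powr_mono2') (auto simp: k'_def)
      finally have "4 * K * (2 * k powr (- \<beta>)) \<le> 4 * K * k' powr (- \<beta>)"
        using K by (intro mult_left_mono) auto
      then show ?thesis using IH S'(3) unfolding k_def by linarith
    qed
  qed
  then have "F A \<le> M\<^sup>2 + 8 * K * M powr (- \<beta>) - 4 * K * card A powr (- \<beta>)" if "M < card A"
    using that by simp
  moreover have "4 * K * card A powr (- \<beta>) \<ge> 0" "8 * K * M powr (- \<beta>) \<ge> 0" using K by auto
  ultimately show ?thesis using small[of A] by (cases "M < card A") auto
qed

text \<open>The factors stem, in order, from the halving in \<open>good_part_bound\<close>, the
  geometric series, the interpolated bounds, the \<open>2 R\<close> of \<open>weak_type_sum\<close>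
  and the \<open>2^19\<close> in the popularity threshold.\<close>

definition step_const :: real where
  "step_const = 2 powr (702/551) * (2 / (1 - 2 powr (- 151/551))) * 512 * 2 powr (151/551)
    * (2 ^ 19) powr (40/551)"

lemma step_const_pos: "step_const > 0"
  by (simp add: step_const_def powr_less_one)

lemma finite_ratio_set: "finite A \<Longrightarrow> finite B \<Longrightarrow> finite (ratio_set A B)"
  by (rule finite_subset[of _ "(\<lambda>(x, y). x / y) ` (A \<times> B)"]) (auto simp: ratio_set_def)

section \<open>Quotients and products in a common setting\<close>

text \<open>Instantiated by division with \<open>Q\<close> the ratio set, \<open>C\<close> the
  inverses of \<open>P\<close> and \<phi> inversion, and by multiplication with \<open>Q\<close> the
  product set, \<open>C = P\<close> and \<phi> the identity. \<open>core\<close> places on the line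
  of slope \<open>l\<close> a dilate of \<open>C\<close> for each representation of
  \<open>l\<close>; \<open>fst_pt\<close> and \<open>snd_pt\<close> serve a good first or second
  factor.\<close>

locale product_setup =
  fixes A P C Q :: "real set" and f :: "real \<Rightarrow> real \<Rightarrow> real" and \<phi> :: "real \<Rightarrow> real"
  assumes finA: "finite A" and P_def: "P = {a \<in> A. a > 0}" and Pne: "P \<noteq> {}"
    and C: "C \<subseteq> {0<..}" "card C = card P"
    and finQ: "finite Q"
    and core: "\<And>l a c. a \<in> A \<Longrightarrow> l * a \<in> P \<Longrightarrow> c \<in> C \<Longrightarrow> a * c \<in> Q \<and> l * (a * c) \<in> Q"
    and fQ: "\<And>x y. x \<in> A - {0} \<Longrightarrow> y \<in> A - {0} \<Longrightarrow> f x y \<in> Q \<and> f x y \<noteq> 0"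
    and fst_pt: "\<And>x y b. x \<in> A - {0} \<Longrightarrow> y \<in> A - {0} \<Longrightarrow> b \<in> P \<Longrightarrow> (b / x) * f x y \<in> Q"
    and \<phi>: "inj \<phi>" "\<phi> 0 = 0"
    and snd_pt: "\<And>x y b. x \<in> A - {0} \<Longrightarrow> y \<in> A - {0} \<Longrightarrow> b \<in> P \<Longrightarrow> \<phi> (b / y) * f x y \<in> Q"
begin

definition N :: real where "N = card P"
definition R :: real where "R = card (ratio_set A A)"
definition s :: real where "s = card (Q + Q)"
definition prods :: "real set \<Rightarrow> real set" where "prods S = {f x y | x y. x \<in> S \<and> y \<in> S}"

lemma finP: "finite P" using finA by (simp add: P_def)

lemma finC: "finite C"
  using C(2) Pne finP by (metis card.infinite card_gt_0_iff less_irrefl)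

lemma N_pos: "N > 0" using Pne finP by (simp add: N_def card_gt_0_iff)

lemma fin_ratio: "finite (ratio_set A A)"
  using finA by (rule finite_ratio_set) (rule finA)

lemma ratio_mem: "b \<in> P \<Longrightarrow> g \<in> A - {0} \<Longrightarrow> b / g \<in> ratio_set A A"
  by (auto simp: ratio_set_def P_def)

lemma R_pos: "R > 0"
proof -
  obtain p where "p \<in> P" using Pne by blast
  then have "p / p \<in> ratio_set A A" by (intro ratio_mem) (auto simp: P_def)
  then show ?thesis using fin_ratio by (auto simp: R_def card_gt_0_iff)
qed

text \<open>For one fixed \<open>p\<close> in \<open>P\<close>, the \<open>N\<close> lines of slopes
  \<open>b / p\<close> all carry the \<open>N\<close> points over the dilate of \<open>C\<close> by
  \<open>p\<close>.\<close>

lemma cube_le: "N ^ 3 \<le> 3 * s\<^sup>2"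
proof -
  obtain p where p: "p \<in> P" using Pne by blast
  then have p0: "p > 0" "p \<in> A" by (auto simp: P_def)
  define E where "E = (\<lambda>b. b / p) ` P"
  have pt: "l \<in> E \<Longrightarrow> l * p \<in> P" for l using p0 by (auto simp: E_def)
  have "card E * N\<^sup>2 \<le> 3 * (card (Q + Q) * card (Q + Q))"
  proof (rule lines_grid_bound[where Y = "\<lambda>l. (*) p ` C"])
    show "0 \<notin> E" using p0 by (auto simp: E_def P_def)
    have "card ((*) p ` C) = card C" using p0 by (intro card_image inj_onI) auto
    then show "N \<le> card ((*) p ` C)" by (simp add: N_def C)
    show "(*) p ` C \<subseteq> {0<..}" using p0 C by auto
    fix l k x x' assume h: "l \<in> E" "k \<in> E" "x \<in> (*) p ` C" "x' \<in> (*) p ` C"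
    then obtain c c' where c: "c \<in> C" "c' \<in> C" "x = p * c" "x' = p * c'" by auto
    show "x + x' \<in> Q + Q \<and> l * x + k * x' \<in> Q + Q"
      using core[OF p0(2) pt[OF h(1)] c(1)] core[OF p0(2) pt[OF h(2)] c(2)]
      unfolding c(3,4) by (auto intro!: set_plus_intro)
  qed (use finP finQ finC N_pos in \<open>auto simp: E_def finite_set_plus\<close>)
  moreover have "card E = card P" unfolding E_def using p0 by (intro card_image inj_onI) auto
  ultimately show ?thesis by (simp add: N_def s_def power2_eq_square power3_eq_cube mult.assoc)
qed

lemma s_pos: "s > 0"
proof -
  have "0 < N ^ 3" using N_pos by simp
  then have "0 < s\<^sup>2" using cube_le by linarith
  then show ?thesis by (simp add: s_def zero_less_power2)
qed

text \<open>With \<open>m = card S\<close>, \<open>U m^(-40/551)\<close> bounds the 702/551 power of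
  the number of elements of one sign with a good factor in a given place. The exponents collect 1142
  = 702 + 400 + 40 and 191 = 151 + 40.\<close>

definition U :: real where
  "U = step_const * s\<^sup>2 * R powr (191/551) / N powr (1142/551)"

lemma U_pos: "U > 0" using step_const_pos s_pos R_pos N_pos by (simp add: U_def)

text \<open>The \<open>N card S\<close> pairs are spread over \<open>R\<close> slopes, so the
  threshold \<open>t\<close> is the average multiplicity divided by \<open>2^19\<close>.\<close>

lemma part_bound:
  fixes G :: "real set" and g \<psi> :: "real \<Rightarrow> real" and e t :: real
  assumes S: "S \<subseteq> A - {0}" "S \<noteq> {}" and \<psi>: "inj \<psi>" "\<psi> 0 = 0" and e: "e = 1 \<or> e = - 1"
    and G: "G \<subseteq> Q" "\<And>q. q \<in> G \<Longrightarrow> e * q > 0" "\<And>q. q \<in> G \<Longrightarrow> g q \<in> A - {0}"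
    and pts: "\<And>q b. q \<in> G \<Longrightarrow> b \<in> P \<Longrightarrow> \<psi> (b / g q) * q \<in> Q"
    and t: "t = N * card S / (2 ^ 19 * R)"
    and good: "\<And>q. q \<in> G \<Longrightarrow> card P \<le> 2 * card {b \<in> P. t \<le> card {a \<in> S. b / g q * a \<in> P}}"
  shows "card G \<le> U powr (551/702) * card S powr (- 20/351)"
proof -
  define m where "m = real (card S)"
  have finS: "finite S" using S finA finite_subset by blast
  have m0: "m > 0" using S finS by (simp add: m_def card_gt_0_iff)
  have t0: "t > 0" using t N_pos m0 R_pos by (simp add: m_def)
  define X where "X = real (card G)"
  define c1 where "c1 = 2 / (1 - 2 powr (- 151/551 :: real))"
  have main: "(X * N / 2) powr (702/551) \<le> c1 * (512 * s\<^sup>2 / (N powr (400/551) * t powr (40/551)))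
      * (2 * R) powr (151/551)"
    unfolding X_def N_def s_def c1_def
  proof (rule good_part_bound[where C = C and S = S and Lam = "ratio_set A A" and g = g and \<phi> = \<psi> and e = e])
    show "P \<subseteq> {0<..}" by (auto simp: P_def)
    show "real (card P) ^ 3 \<le> 3 * (real (card (Q + Q)))\<^sup>2" using cube_le by (simp add: N_def s_def)
    show "card (ratio_set A A) \<le> R" by (simp add: R_def)
    show "\<And>q b. q \<in> G \<Longrightarrow> b \<in> P \<Longrightarrow> b / g q \<in> ratio_set A A" using G(3) ratio_mem by blast
    show "\<And>q. q \<in> G \<Longrightarrow> g q \<noteq> 0" using G(3) by auto
    fix l a c assume "a \<in> S" "l * a \<in> P" "c \<in> C"
    then show "a * c \<in> Q \<and> l * (a * c) \<in> Q" using S by (intro core) auto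
  qed (use finP Pne finQ finS t0 finC C fin_ratio R_pos \<psi> e G pts good in auto)
  have "X powr (702/551) \<le> U * m powr (- 40/551)"
  proof -
    have tp: "t powr (40/551) = N powr (40/551) * m powr (40/551) / ((2 ^ 19) powr (40/551) * R powr (40/551))"
      unfolding t m_def[symmetric] using N_pos m0 R_pos by (simp add: powr_mult powr_divide)
    have l: "(X * N / 2) powr (702/551) = X powr (702/551) * N powr (702/551) / 2 powr (702/551)"
      using N_pos by (simp add: X_def powr_mult powr_divide)
    have NN: "N powr (702/551) * N powr (400/551) * N powr (40/551) = N powr (1142/551)"
      by (simp flip: powr_add)
    have RR: "R powr (151/551) * R powr (40/551) = R powr (191/551)" by (simp flip: powr_add)
    have mm: "m powr (- 40/551) = 1 / m powr (40/551)" using powr_minus_divide[of m "40/551"] by simp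
    define n1 n2 n3 m1 r1 r2 where d: "n1 = N powr (702/551)" "n2 = N powr (400/551)" "n3 = N powr (40/551)"
      "m1 = m powr (40/551)" "r1 = R powr (151/551)" "r2 = R powr (40/551)"
    have pos: "n1 > 0" "n2 > 0" "n3 > 0" "m1 > 0" "r1 > 0" "r2 > 0"
      using N_pos m0 R_pos by (simp_all add: d)
    define k1 k2 k3 :: real where k: "k1 = 2 powr (702/551)" "k2 = 2 powr (151/551)" "k3 = (2 ^ 19) powr (40/551)"
    have kpos: "k1 > 0" "k2 > 0" "k3 > 0" by (simp_all add: k)
    have "X powr (702/551) * n1 / k1 \<le> c1 * (512 * s\<^sup>2 / (n2 * (n3 * m1 / (k3 * r2)))) * (k2 * r1)"
      using main unfolding l tp d k using R_pos by (simp add: powr_mult)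
    then have "X powr (702/551) \<le> c1 * (512 * s\<^sup>2 / (n2 * (n3 * m1 / (k3 * r2)))) * (k2 * r1) * k1 / n1"
      using pos kpos by (simp add: field_simps)
    also have "\<dots> = (k1 * c1 * 512 * k2 * k3) * s\<^sup>2 * (r1 * r2) / (n1 * n2 * n3) * (1 / m1)"
      using pos kpos by (simp add: field_simps)
    also have "\<dots> = U * m powr (- 40/551)"
      unfolding d RR NN mm[symmetric] U_def step_const_def c1_def k by simp
    finally show ?thesis .
  qed
  then have "(X powr (702/551)) powr (551/702) \<le> (U * m powr (- 40/551)) powr (551/702)"
    by (intro powr_mono2) auto
  moreover have "(X powr (702/551)) powr (551/702) = X" by (simp add: powr_powr X_def)
  moreover have "(U * m powr (- 40/551)) powr (551/702) = U powr (551/702) * m powr (- 20/351)"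
    using U_pos by (simp add: powr_mult powr_powr)
  ultimately show ?thesis by (simp add: X_def m_def)
qed

text \<open>Elements of \<open>Q\<close> with a good factor fall into four classes, by their sign
  and the place of the good factor, each controlled by \<open>part_bound\<close>. The rest have both
  factors in the set \<open>S'\<close> of bad elements.\<close>

lemma descent_step:
  assumes S: "S \<subseteq> A - {0}" "S \<noteq> {}"
  shows "\<exists>S'\<subseteq>S. card S' \<le> (1 / 2 ^ 18) * real (card S) \<and>
    card (prods S) \<le> 4 * U powr (551/702) * card S powr (- (20/351)) + card (prods S')"
proof -
  define m where "m = real (card S)"
  define t where "t = N * card S / (2 ^ 19 * R)"
  define r where "r = (\<lambda>l. card {a \<in> S. l * a \<in> P})"
  define good where "good = (\<lambda>g. card P \<le> 2 * card {b \<in> P. t \<le> r (b / g)})"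
  define S' where "S' = {g \<in> S. \<not> good g}"
  have finS: "finite S" using S finA finite_subset by blast
  have S0: "x \<in> S \<Longrightarrow> x \<in> A - {0}" for x using S by auto
  have "card S' \<le> (1 / 2 ^ 18) * real (card S)"
  proof -
    \<comment> \<open>A bad \<open>g\<close> sends at least half of \<open>P\<close> to unpopular
      slopes, and these have at most \<open>R t = N m / 2^19\<close> representations in
      total.\<close>
    define L where "L = {l \<in> ratio_set A A. r l < t}"
    have finL: "finite L" using fin_ratio by (simp add: L_def)
    have half: "card P \<le> 2 * card {b \<in> P. r (b / g) < t}" if "g \<in> S'" for g
    proof -
      have "P = {b \<in> P. t \<le> r (b / g)} \<union> {b \<in> P. r (b / g) < t}" by auto
      then have "card P \<le> card {b \<in> P. t \<le> r (b / g)} + card {b \<in> P. r (b / g) < t}"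
        by (metis card_Un_le)
      then show ?thesis using that by (simp add: S'_def good_def)
    qed
    have "card S' * card P = (\<Sum>g\<in>S'. card P)" by simp
    also have "\<dots> \<le> (\<Sum>g\<in>S'. 2 * card {b \<in> P. r (b / g) < t})" by (intro sum_mono half)
    also have "\<dots> = 2 * card (SIGMA g:S'. {b \<in> P. r (b / g) < t})"
      using finS finP by (subst card_SigmaI) (auto simp: S'_def sum_distrib_left)
    also have "card (SIGMA g:S'. {b \<in> P. r (b / g) < t}) \<le> card (SIGMA l:L. {a \<in> S. l * a \<in> P})"
    proof (rule card_inj_on_le[where f = "\<lambda>(g, b). (b / g, g)"])
      show "inj_on (\<lambda>(g, b). (b / g, g)) (SIGMA g:S'. {b \<in> P. r (b / g) < t})"
        using S0 by (auto intro!: inj_onI simp: S'_def)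
      show "(\<lambda>(g, b). (b / g, g)) ` (SIGMA g:S'. {b \<in> P. r (b / g) < t}) \<subseteq> (SIGMA l:L. {a \<in> S. l * a \<in> P})"
        using S0 ratio_mem by (auto simp: S'_def L_def)
      show "finite (SIGMA l:L. {a \<in> S. l * a \<in> P})" using finL finS by auto
    qed
    also have "card (SIGMA l:L. {a \<in> S. l * a \<in> P}) = (\<Sum>l\<in>L. r l)"
      using finL finS by (subst card_SigmaI) (auto simp: r_def)
    finally have "card S' * card P \<le> 2 * (\<Sum>l\<in>L. r l)" by simp
    then have "real (card S' * card P) \<le> real (2 * (\<Sum>l\<in>L. r l))" by (subst of_nat_le_iff)
    also have "\<dots> = 2 * (\<Sum>l\<in>L. real (r l))" by simp
    also have "\<dots> \<le> 2 * (\<Sum>l\<in>L. t)"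
      by (intro mult_left_mono sum_mono) (auto simp: L_def)
    also have "\<dots> = 2 * (card L * t)" by simp
    also have "\<dots> \<le> 2 * (R * t)"
    proof -
      have "card L \<le> card (ratio_set A A)" using fin_ratio by (intro card_mono) (auto simp: L_def)
      then have "real (card L) \<le> R" by (simp add: R_def)
      moreover have "t \<ge> 0" using N_pos R_pos by (simp add: t_def)
      ultimately show ?thesis by (intro mult_left_mono mult_right_mono) auto
    qed
    also have "\<dots> = N * m / 2 ^ 18" using R_pos by (simp add: t_def m_def)
    finally have "N * card S' \<le> N * (m / 2 ^ 18)" by (simp add: N_def mult.commute)
    then show ?thesis using N_pos by (simp add: m_def)
  qed
  moreover have "card (prods S) \<le> 4 * U powr (551/702) * card S powr (- (20/351)) + card (prods S')"
  proof -
    define b where "b = U powr (551/702) * m powr (- 20/351)"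
    define G1 where "G1 = (\<lambda>e. {q. e * q > 0 \<and> (\<exists>x\<in>S - S'. \<exists>y\<in>S. q = f x y)})"
    define G2 where "G2 = (\<lambda>e. {q. e * q > 0 \<and> (\<exists>y\<in>S - S'. \<exists>x\<in>S. q = f x y)})"
    have gd: "good x" if "x \<in> S - S'" for x using that by (simp add: S'_def)
    have b1: "card (G1 e) \<le> b" if e: "e = 1 \<or> e = - 1" for e
    proof -
      have "\<exists>x. q \<in> G1 e \<longrightarrow> x \<in> S - S' \<and> (\<exists>y\<in>S. q = f x y)" for q by (auto simp: G1_def)
      then obtain g where g: "\<And>q. q \<in> G1 e \<Longrightarrow> g q \<in> S - S' \<and> (\<exists>y\<in>S. q = f (g q) y)" by metis
      show ?thesis unfolding b_def m_def
      proof (rule part_bound[where \<psi> = "\<lambda>x. x" and g = g and e = e and t = t])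
        fix q assume q: "q \<in> G1 e"
        then obtain y where y: "y \<in> S" "q = f (g q) y" and gq: "g q \<in> S - S'" using g by blast
        show "g q \<in> A - {0}" using gq S0 by auto
        show "card P \<le> 2 * card {b \<in> P. t \<le> card {a \<in> S. b / g q * a \<in> P}}"
          using gd[OF gq] by (simp add: good_def r_def)
        show "b / g q * q \<in> Q" if "b \<in> P" for b
          using fst_pt[of "g q" y b] y gq S0 that by auto
      qed (use S e fQ S0 in \<open>auto simp: G1_def t_def inj_on_def\<close>)
    qed
    have b2: "card (G2 e) \<le> b" if e: "e = 1 \<or> e = - 1" for e
    proof -
      have "\<exists>y. q \<in> G2 e \<longrightarrow> y \<in> S - S' \<and> (\<exists>x\<in>S. q = f x y)" for q by (auto simp: G2_def)
      then obtain g where g: "\<And>q. q \<in> G2 e \<Longrightarrow> g q \<in> S - S' \<and> (\<exists>x\<in>S. q = f x (g q))" by metis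
      show ?thesis unfolding b_def m_def
      proof (rule part_bound[where \<psi> = \<phi> and g = g and e = e and t = t])
        fix q assume q: "q \<in> G2 e"
        then obtain x where x: "x \<in> S" "q = f x (g q)" and gq: "g q \<in> S - S'" using g by blast
        show "g q \<in> A - {0}" using gq S0 by auto
        show "card P \<le> 2 * card {b \<in> P. t \<le> card {a \<in> S. b / g q * a \<in> P}}"
          using gd[OF gq] by (simp add: good_def r_def)
        show "\<phi> (b / g q) * q \<in> Q" if "b \<in> P" for b
          using snd_pt[of x "g q" b] x gq S0 that by auto
      qed (use S e fQ S0 \<phi> in \<open>auto simp: G2_def t_def\<close>)
    qed
    have "prods S \<subseteq> G1 1 \<union> G1 (- 1) \<union> G2 1 \<union> G2 (- 1) \<union> prods S'"
    proof
      fix q assume "q \<in> prods S"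
      then obtain x y where xy: "x \<in> S" "y \<in> S" "q = f x y" by (auto simp: prods_def)
      then have "q \<noteq> 0" using fQ S0 by auto
      then consider "q > 0" | "q < 0" by linarith
      then show "q \<in> G1 1 \<union> G1 (- 1) \<union> G2 1 \<union> G2 (- 1) \<union> prods S'"
        using xy by cases (auto simp: G1_def G2_def prods_def)
    qed
    moreover have "finite (G1 1 \<union> G1 (- 1) \<union> G2 1 \<union> G2 (- 1) \<union> prods S')"
      by (rule finite_subset[OF _ finQ]) (use fQ S0 in \<open>auto simp: G1_def G2_def prods_def S'_def\<close>)
    ultimately have "card (prods S) \<le> card (G1 1 \<union> G1 (- 1) \<union> G2 1 \<union> G2 (- 1) \<union> prods S')"
      by (rule card_mono[rotated])
    also have "\<dots> \<le> card (G1 1) + card (G1 (- 1)) + card (G2 1) + card (G2 (- 1)) + card (prods S')"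
      by (meson add_mono_thms_linordered_semiring(3) card_Un_le le_trans)
    finally have "real (card (prods S))
        \<le> card (G1 1) + card (G1 (- 1)) + card (G2 1) + card (G2 (- 1)) + card (prods S')"
      by (simp flip: of_nat_add)
    then show ?thesis using b1[of 1] b1[of "- 1"] b2[of 1] b2[of "- 1"] by (simp add: b_def m_def)
  qed
  moreover have "S' \<subseteq> S" by (auto simp: S'_def)
  ultimately show ?thesis by blast
qed

text \<open>\<open>M\<close> balances the terms of \<open>descent_bound\<close>: both
  \<open>M^2\<close> and \<open>K M^(-20/351)\<close> equal \<open>K^(351/361)\<close>, that is
  \<open>U^(29/38)\<close>, and 1 + 8 = 9.\<close>

lemma prods_bound: "card (prods (A - {0})) powr (38/29) \<le> 9 powr (38/29) * U"
proof -
  define K where "K = U powr (551/702)"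
  define M where "M = K powr (351/722)"
  have K: "K > 0" using U_pos by (simp add: K_def)
  have le: "card (prods (A - {0})) \<le> M\<^sup>2 + 8 * K * M powr (- (20/351))"
  proof (rule descent_bound[where \<delta> = "1 / 2 ^ 18" and F = "\<lambda>S. card (prods S)"])
    \<comment> \<open>The exponent 18 is the least integer whose product with 20/351 reaches 1, as
      the doubling condition requires.\<close>
    have "(2::real) powr 1 \<le> 2 powr ((- 18) * (- (20/351)))" by (intro powr_mono) auto
    also have "\<dots> = (2 powr (- 18)) powr (- (20/351))" by (rule powr_powr[symmetric])
    also have "(2::real) powr (- 18) = 1 / 2 ^ 18" by (simp add: powr_minus_divide)
    finally show "2 \<le> ((1::real) / 2 ^ 18) powr - (20/351)" by simp
    show "card (prods S) \<le> (card S)\<^sup>2" if "S \<subseteq> A - {0}" for S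
    proof -
      have finS: "finite S" using that finA finite_subset by blast
      have "prods S = (\<lambda>(x, y). f x y) ` (S \<times> S)" by (auto simp: prods_def)
      then have "card (prods S) \<le> card (S \<times> S)" using finS by (metis card_image_le finite_SigmaI)
      then show ?thesis by (simp add: card_cartesian_product power2_eq_square)
    qed
  qed (use K finA descent_step in \<open>auto simp: M_def K_def\<close>)
  have M2: "M\<^sup>2 = K powr (351/361)"
    using K by (simp add: M_def power2_eq_square flip: powr_add)
  have "M powr (- (20/351)) = K powr (- (10/361))" by (simp add: M_def powr_powr)
  then have "K * M powr (- (20/351)) = K powr 1 * K powr (- (10/361))" using K by simp
  also have "\<dots> = K powr (1 + - (10/361))" by (rule powr_add[symmetric])
  finally have "K * M powr (- (20/351)) = K powr (351/361)" by simp
  then have "card (prods (A - {0})) \<le> 9 * K powr (351/361)" using le M2 by simp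
  also have "K powr (351/361) = U powr (29/38)" by (simp add: K_def powr_powr)
  finally have "card (prods (A - {0})) powr (38/29) \<le> (9 * U powr (29/38)) powr (38/29)"
    by (intro powr_mono2) auto
  also have "\<dots> = 9 powr (38/29) * U" using U_pos by (simp add: powr_mult powr_powr)
  finally show ?thesis .
qed

end

section \<open>The two inequalities\<close>

definition sum_const :: real where
  "sum_const = (9 powr (38/29) * step_const * 4 powr (1142/551)) powr (1/2)"

lemma sum_const_pos: "sum_const > 0"
  using step_const_pos by (simp add: sum_const_def)

context product_setup
begin

text \<open>Unfolding \<open>U\<close> in \<open>prods_bound\<close> and taking a square root
  isolates \<open>s\<close>. An excess \<open>R^(1/551)\<close> remains; \<open>R <= n^2\<close>
  turns it into \<open>n^(2/551)\<close>, exactly the surplus of 1142/551 over 60/29. Then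
  \<open>maj\<close> replaces \<open>n\<close> by \<open>4 N\<close>.\<close>

lemma sumset_bound:
  assumes maj: "card A \<le> 4 * card P"
  shows "card (prods (A - {0})) powr (19/29) * card A powr (30/29) * R powr (- (5/29)) \<le> sum_const * s"
proof -
  define n where "n = real (card A)"
  define X where "X = real (card (prods (A - {0})))"
  define c where "c = 9 powr (38/29) * step_const"
  have c0: "c > 0" using step_const_pos by (simp add: c_def)
  have n4: "n \<le> 4 * N" using maj by (simp add: n_def N_def)
  have "card P \<le> card A" using finA by (intro card_mono) (auto simp: P_def)
  then have n0: "n > 0" using N_pos by (simp add: n_def N_def)
  have Rn: "R \<le> n powr 2"
  proof -
    have "ratio_set A A \<subseteq> (\<lambda>(x, y). x / y) ` (A \<times> A)" by (auto simp: ratio_set_def)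
    then have "card (ratio_set A A) \<le> card ((\<lambda>(x, y). x / y) ` (A \<times> A))"
      using finA by (intro card_mono) auto
    also have "\<dots> \<le> card (A \<times> A)" using finA by (intro card_image_le) auto
    finally have "real (card (ratio_set A A)) \<le> real (card A * card A)"
      by (simp only: card_cartesian_product of_nat_le_iff)
    then show ?thesis using n0 by (simp add: R_def n_def power2_eq_square)
  qed
  have "X powr (38/29) * n powr (60/29) * R powr (- (10/29))
      \<le> (c * s\<^sup>2 * R powr (191/551) / N powr (1142/551)) * n powr (60/29) * R powr (- (10/29))"
    using prods_bound by (intro mult_right_mono) (simp_all add: X_def c_def U_def mult.assoc)
  also have "\<dots> = c * s\<^sup>2 * (n powr (60/29) * R powr (1/551)) / N powr (1142/551)"
  proof -
    have "R powr (191/551) * R powr (- (10/29)) = R powr (1/551)" by (simp flip: powr_add)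
    then show ?thesis by (simp add: field_simps)
  qed
  also have "\<dots> \<le> c * s\<^sup>2 * n powr (1142/551) / N powr (1142/551)"
  proof -
    have "R powr (1/551) \<le> (n powr 2) powr (1/551)" using Rn R_pos by (intro powr_mono2) auto
    also have "\<dots> = n powr (2/551)" by (subst powr_powr) simp
    finally have "n powr (60/29) * R powr (1/551) \<le> n powr (60/29) * n powr (2/551)"
      by (intro mult_left_mono) auto
    also have "\<dots> = n powr (1142/551)" by (simp flip: powr_add)
    finally show ?thesis using c0 by (intro divide_right_mono mult_left_mono) auto
  qed
  also have "\<dots> \<le> c * s\<^sup>2 * (4 powr (1142/551) * N powr (1142/551)) / N powr (1142/551)"
  proof -
    have "n powr (1142/551) \<le> (4 * N) powr (1142/551)" using n4 n0 by (intro powr_mono2) auto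
    then show ?thesis using c0 N_pos by (intro divide_right_mono mult_left_mono) (auto simp: powr_mult)
  qed
  also have "\<dots> = (c * 4 powr (1142/551)) * s\<^sup>2" using N_pos by simp
  finally have sq: "X powr (38/29) * n powr (60/29) * R powr (- (10/29)) \<le> (c * 4 powr (1142/551)) * s\<^sup>2" .
  have "(X powr (38/29) * n powr (60/29) * R powr (- (10/29))) powr (1/2)
      = X powr (19/29) * n powr (30/29) * R powr (- (5/29))"
    by (simp add: powr_mult powr_powr)
  moreover have "((c * 4 powr (1142/551)) * s\<^sup>2) powr (1/2) = sum_const * s"
  proof -
    have "(s\<^sup>2) powr (1/2) = s" using s_pos by (simp add: powr_half_sqrt)
    then show ?thesis using c0 by (simp add: powr_mult sum_const_def c_def)
  qed
  ultimately show ?thesis using powr_mono2[OF _ _ sq, of "1/2"] by (simp add: X_def n_def)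
qed

end

text \<open>Compensates for removing 0 from \<open>A\<close>, which can cost \<open>Q\<close> only
  the element 0.\<close>

lemma powr_card_double:
  fixes Q X :: "real set"
  assumes "finite X" "X \<noteq> {}" "Q \<subseteq> insert 0 X"
  shows "card Q powr (19/29) \<le> 2 * card X powr (19/29)"
proof -
  have "card Q \<le> card (insert 0 X)" using assms by (intro card_mono) auto
  also have "\<dots> \<le> card X + 1" using assms by (simp add: card_insert_if)
  also have "\<dots> \<le> 2 * card X" using assms by (simp add: Suc_le_eq card_gt_0_iff)
  finally have "card Q powr (19/29) \<le> (2 * real (card X)) powr (19/29)"
    by (intro powr_mono2) (simp_all flip: of_nat_mult)
  also have "\<dots> = 2 powr (19/29) * card X powr (19/29)" by (simp add: powr_mult)
  also have "\<dots> \<le> 2 powr 1 * card X powr (19/29)" by (intro mult_right_mono powr_mono) auto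
  finally show ?thesis by simp
qed

text \<open>The two instances of \<open>product_setup\<close>. For quotients \<open>Q\<close> is the
  ratio set itself, so the exponents 19/29 and -5/29 merge into 14/29.\<close>

lemma positive_majority_bounds:
  fixes A :: "real set"
  assumes fin: "finite A" and maj: "card A \<le> 4 * card {a \<in> A. a > 0}" and ne: "{a \<in> A. a > 0} \<noteq> {}"
  shows "card (ratio_set A A) powr (14/29) * card A powr (30/29)
      \<le> 2 * sum_const * card (ratio_set A A + ratio_set A A)"
    and "card (A * A) powr (19/29) * card A powr (30/29) * card (ratio_set A A) powr (- (5/29))
      \<le> 2 * sum_const * card (A * A + A * A)"
proof -
  define P where "P = {a \<in> A. a > 0}"
  define Q where "Q = ratio_set A A"
  obtain p where p: "p \<in> A" "p > 0" using ne by auto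
  have finP: "finite P" using fin by (simp add: P_def)
  interpret rat: product_setup A P "inverse ` P" Q "(/)" inverse
  proof
    show "card (inverse ` P) = card P" by (intro card_image inj_onI) simp
    show "inj (inverse :: real \<Rightarrow> real)" by (auto intro: injI)
    show "a * c \<in> Q \<and> l * (a * c) \<in> Q" if mem: "a \<in> A" "l * a \<in> P" "c \<in> inverse ` P" for l a c
    proof -
      obtain d where d: "d \<in> A" "d > 0" "c = inverse d" using mem(3) by (auto simp: P_def)
      have "a * c = a / d" "l * (a * c) = (l * a) / d" by (simp_all add: d field_simps)
      moreover have "l * a \<in> A" using mem(2) by (simp add: P_def)
      ultimately show ?thesis using mem(1) d unfolding Q_def ratio_set_def by auto
    qed
    show "x / y \<in> Q \<and> x / y \<noteq> 0" if "x \<in> A - {0}" "y \<in> A - {0}" for x y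
      using that by (auto simp: Q_def ratio_set_def)
    show "b / x * (x / y) \<in> Q" if "x \<in> A - {0}" "y \<in> A - {0}" "b \<in> P" for x y b
      using that by (auto simp: Q_def ratio_set_def P_def)
    \<comment> \<open>For a good denominator \<open>y\<close> the point is
      \<open>(x / y, x / b)\<close>, on a line of slope \<open>y / b\<close>; this is why \<phi>
      inverts.\<close>
    show "inverse (b / y) * (x / y) \<in> Q" if "x \<in> A - {0}" "y \<in> A - {0}" "b \<in> P" for x y b
    proof -
      have "inverse (b / y) * (x / y) = x / b" using that by (simp add: field_simps)
      then show ?thesis using that by (auto simp: Q_def ratio_set_def P_def)
    qed
  qed (use fin ne in \<open>auto simp: P_def Q_def finite_ratio_set\<close>)
  have "1 \<in> rat.prods (A - {0})" using p by (auto simp: rat.prods_def intro!: exI[of _ p])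
  moreover have "finite (rat.prods (A - {0}))"
    by (rule finite_subset[OF _ rat.finQ]) (use rat.fQ in \<open>auto simp: rat.prods_def\<close>)
  moreover have "Q \<subseteq> insert 0 (rat.prods (A - {0}))"
    unfolding Q_def ratio_set_def rat.prods_def by auto blast
  ultimately have "card Q powr (19/29) \<le> 2 * card (rat.prods (A - {0})) powr (19/29)"
    by (intro powr_card_double) auto
  then have "card Q powr (19/29) * (card A powr (30/29) * card Q powr (- (5/29)))
      \<le> 2 * card (rat.prods (A - {0})) powr (19/29) * (card A powr (30/29) * card Q powr (- (5/29)))"
    by (intro mult_right_mono) auto
  also have "\<dots> \<le> 2 * (sum_const * card (Q + Q))"
    using rat.sumset_bound[unfolded rat.s_def rat.R_def, folded Q_def] maj
    by (simp add: P_def mult.assoc)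
  finally have "(card Q powr (19/29) * card Q powr (- (5/29))) * card A powr (30/29)
      \<le> 2 * sum_const * card (Q + Q)" by (simp add: mult_ac)
  then show "card (ratio_set A A) powr (14/29) * card A powr (30/29)
      \<le> 2 * sum_const * card (ratio_set A A + ratio_set A A)"
    by (simp add: Q_def flip: powr_add)

  interpret prd: product_setup A P P "A * A" "(*)" "\<lambda>x. x"
  proof
    show "a * c \<in> A * A \<and> l * (a * c) \<in> A * A" if "a \<in> A" "l * a \<in> P" "c \<in> P" for l a c
    proof -
      have "l * a \<in> A" "c \<in> A" using that by (auto simp: P_def)
      then have "(l * a) * c \<in> A * A" "a * c \<in> A * A" using that by (auto intro!: set_times_intro)
      then show ?thesis by (simp add: mult.assoc)
    qed
    show "b / x * (x * y) \<in> A * A" if "x \<in> A - {0}" "y \<in> A - {0}" "b \<in> P" for x y b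
    proof -
      have "b / x * (x * y) = b * y" using that by simp
      then show ?thesis using that by (auto simp: P_def intro!: set_times_intro)
    qed
    show "b / y * (x * y) \<in> A * A" if "x \<in> A - {0}" "y \<in> A - {0}" "b \<in> P" for x y b
    proof -
      have "b / y * (x * y) = b * x" using that by simp
      then show ?thesis using that by (auto simp: P_def intro!: set_times_intro)
    qed
  qed (use fin ne in \<open>auto simp: P_def finite_set_times inj_on_def intro!: set_times_intro\<close>)
  have "p * p \<in> prd.prods (A - {0})" using p by (auto simp: prd.prods_def intro!: exI[of _ p])
  moreover have "finite (prd.prods (A - {0}))"
    by (rule finite_subset[OF _ prd.finQ]) (use prd.fQ in \<open>auto simp: prd.prods_def\<close>)
  moreover have "A * A \<subseteq> insert 0 (prd.prods (A - {0}))"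
    unfolding prd.prods_def by (auto elim!: set_times_elim) blast
  ultimately have "card (A * A) powr (19/29) \<le> 2 * card (prd.prods (A - {0})) powr (19/29)"
    by (intro powr_card_double) auto
  then have "card (A * A) powr (19/29) * (card A powr (30/29) * card Q powr (- (5/29)))
      \<le> 2 * card (prd.prods (A - {0})) powr (19/29) * (card A powr (30/29) * card Q powr (- (5/29)))"
    by (intro mult_right_mono) auto
  also have "\<dots> \<le> 2 * (sum_const * card (A * A + A * A))"
    using prd.sumset_bound[unfolded prd.s_def prd.R_def, folded Q_def] maj
    by (simp add: P_def mult.assoc)
  finally show "card (A * A) powr (19/29) * card A powr (30/29) * card (ratio_set A A) powr (- (5/29))
      \<le> 2 * sum_const * card (A * A + A * A)"
    by (simp add: Q_def mult.assoc)
qed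

text \<open>If the positive elements are fewer than a quarter of \<open>A\<close>, the negative ones
  are at least a quarter, even after discounting 0. Negating \<open>A\<close> exchanges the two and
  preserves its products and ratios.\<close>

lemma sign_free_bounds:
  fixes A :: "real set"
  assumes fin: "finite A" and two: "card A \<ge> 2"
  shows "card (ratio_set A A) powr (14/29) * card A powr (30/29)
      \<le> 2 * sum_const * card (ratio_set A A + ratio_set A A) \<and>
    card (A * A) powr (19/29) * card A powr (30/29) * card (ratio_set A A) powr (- (5/29))
      \<le> 2 * sum_const * card (A * A + A * A)"
proof -
  define P where "P = {a \<in> A. a > 0}"
  define M where "M = {a \<in> A. a < 0}"
  have "A \<subseteq> insert 0 (P \<union> M)" by (auto simp: P_def M_def)
  then have "card A \<le> card (insert 0 (P \<union> M))" using fin by (intro card_mono) (auto simp: P_def M_def)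
  also have "\<dots> \<le> Suc (card (P \<union> M))" using fin by (simp add: card_insert_if P_def M_def)
  also have "card (P \<union> M) \<le> card P + card M" by (rule card_Un_le)
  finally have cA: "card A \<le> Suc (card P + card M)" by simp
  show ?thesis
  proof (cases "card A \<le> 4 * card P")
    case True
    then have "P \<noteq> {}" using two by auto
    then show ?thesis using positive_majority_bounds[OF fin] True by (auto simp: P_def)
  next
    case False
    define B where "B = uminus ` A"
    have "{a \<in> B. a > 0} = uminus ` M" by (auto simp: B_def M_def image_iff)
    then have cM: "card {a \<in> B. a > 0} = card M" by (simp add: card_image)
    have cB: "card B = card A" by (simp add: B_def card_image)
    have maj: "card B \<le> 4 * card {a \<in> B. a > 0}" using False cA two cM cB by linarith
    have ne: "{a \<in> B. a > 0} \<noteq> {}"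
    proof
      assume e: "{a \<in> B. a > 0} = {}"
      have "card B = 0" using maj unfolding e by simp
      then show False using cB two by simp
    qed
    have ratB: "ratio_set B B = ratio_set A A"
    proof -
      have "ratio_set X X \<subseteq> ratio_set (uminus ` X) (uminus ` X)" for X :: "real set"
      proof
        fix z assume "z \<in> ratio_set X X"
        then obtain x y where "x \<in> X" "y \<in> X" "y \<noteq> 0" "z = (- x) / (- y)" by (auto simp: ratio_set_def)
        then show "z \<in> ratio_set (uminus ` X) (uminus ` X)" unfolding ratio_set_def
          by (metis (mono_tags, lifting) imageI mem_Collect_eq neg_equal_0_iff_equal)
      qed
      from this[of A] this[of B] show ?thesis by (auto simp: B_def image_image)
    qed
    have prodB: "B * B = A * A"
    proof -
      have "X * X \<subseteq> uminus ` X * uminus ` X" for X :: "real set"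
      proof
        fix z assume "z \<in> X * X"
        then obtain x y where "x \<in> X" "y \<in> X" "z = (- x) * (- y)" by (auto elim!: set_times_elim)
        then show "z \<in> uminus ` X * uminus ` X" by (metis imageI set_times_intro)
      qed
      from this[of A] this[of B] show ?thesis by (auto simp: B_def image_image)
    qed
    have "finite B" using fin by (simp add: B_def)
    from positive_majority_bounds[OF this maj ne] show ?thesis by (simp add: ratB prodB cB)
  qed
qed

text \<open>The bounds hold even without the logarithm: from \<open>card A >= 2\<close> its value is
  at least 1, so its negative power is at most 1.\<close>

theorem theorem15:
  "\<exists>c::real. c > 0 \<and> (\<forall>A::real set. finite A \<longrightarrow> card A \<ge> 2 \<longrightarrow>
     real (card (ratio_set A A + ratio_set A A))
       \<ge> c * real (card (ratio_set A A)) powr (14/29) * real (card A) powr (30/29)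
           * log 2 (real (card A)) powr (- (2/29))
   \<and> real (card (A * A + A * A))
       \<ge> c * real (card (A * A)) powr (19/29) * real (card (ratio_set A A)) powr (- (5/29))
           * real (card A) powr (30/29) * log 2 (real (card A)) powr (- (2/29)))"
proof (intro exI[of _ "1 / (2 * sum_const)"] conjI allI impI)
  show "0 < 1 / (2 * sum_const)" using sum_const_pos by simp
  fix A :: "real set"
  assume A: "finite A" "card A \<ge> 2"
  define L where "L = log 2 (real (card A)) powr (- (2/29))"
  have "log 2 (real (card A)) \<ge> 1" using A(2) by (simp add: le_log_iff)
  then have "L \<le> log 2 (real (card A)) powr 0" unfolding L_def by (intro powr_mono) auto
  then have L: "L \<le> 1" using \<open>log 2 (real (card A)) \<ge> 1\<close> by simp
  have div: "1 / (2 * sum_const) * x * L \<le> z" if "x \<le> 2 * sum_const * z" "x \<ge> 0" for x z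
  proof -
    have "x * L \<le> x * 1" using L that(2) by (intro mult_left_mono) auto
    then have "x * L \<le> 2 * sum_const * z" using that(1) by linarith
    then show ?thesis using sum_const_pos by (simp add: field_simps)
  qed
  from sign_free_bounds[OF A]
  have 1: "card (ratio_set A A) powr (14/29) * card A powr (30/29)
      \<le> 2 * sum_const * card (ratio_set A A + ratio_set A A)"
    and 2: "card (A * A) powr (19/29) * card A powr (30/29) * card (ratio_set A A) powr (- (5/29))
      \<le> 2 * sum_const * card (A * A + A * A)" by auto
  show "real (card (ratio_set A A + ratio_set A A))
       \<ge> 1 / (2 * sum_const) * real (card (ratio_set A A)) powr (14/29) * real (card A) powr (30/29)
           * log 2 (real (card A)) powr (- (2/29))"
    using div[OF 1] by (simp add: L_def mult_ac)
  show "real (card (A * A + A * A))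
       \<ge> 1 / (2 * sum_const) * real (card (A * A)) powr (19/29) * real (card (ratio_set A A)) powr (- (5/29))
           * real (card A) powr (30/29) * log 2 (real (card A)) powr (- (2/29))"
    using div[OF 2] by (simp add: L_def mult_ac)
qed

end
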